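(* Fix $\alpha\in(0,1)$, an integer $K\ge23$, and $\kappa>0$, and let $\mathcal X$ be a measurable space containing at least $2K$ distinct points whose singleton sets are measurable. Then there exist probability measures $P_X,Q_X$ on $\mathcal X$ (source and target marginals), distinct points $x_1,\ldots,x_K\in\mathcal X$, a reference conditional kernel $P^0_{Y\mid X}$ from $\mathcal X$ to $\mathbb R$, and a reference score $S^\star:\mathcal X\times\mathbb R\to\mathbb R$, all independent of $m$, such that: (i) $Q_X\ll P_X$, the likelihood ratio $dQ_X/dP_X$ is bounded by a finite constant, $\chi^2(Q_X\Vert P_X)=\kappa$, and $Q_X=\frac1K\sum_{k=1}^K\delta_{x_k}$; (ii) $P^0_{Y\mid X}$ satisfies mass regularity (see context) on a measurable set of full $P_X$-measure; (iii) $S^\star$ is the equal-tailed oracle CQR score under $P^0_{Y\mid X}$, and is held fixed below; and the following holds. Set $$m_\star^{(K)}=\frac{(1+\kappa)\,\alpha(1-\alpha)K}{4\min\{\alpha,1-\alpha\}^2}.$$ Then for every integer $m>m_\star^{(K)}$ and every $p\in[1,\infty]$, $$\inf_{\widehat q_{1:K}}\;\sup_{P_{Y\mid X}}\;\mathbb P_{(P_X\otimes P_{Y\mid X})^{\otimes m}}\Biggl(\bigl\|\mathrm{Cov}^P_{\{S^\star\le\widehat q\}}(\cdot)-(1-\alpha)\bigr\|_{L^p(Q_X)}\ge\frac1{64}\sqrt{\frac{(1+\kappa)\,\alpha(1-\alpha)K}{m}}\Biggr)\ge1-2e^{-K/32},$$ where the infimum is over threshold-vector rules and the supremum over admissible conditional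 kernels (see context).
   Context: $\chi^2(Q_X\Vert P_X)=\int(w-1)^2\,dP_X$ with $w=dQ_X/dP_X$. Quantiles: for a kernel $P_{Y\mid X}$ and $\tau\in(0,1)$, $f_\tau(x)=\inf\{t\in\mathbb R:P_{Y\mid X=x}((-\infty,t])\ge\tau\}$. The equal-tailed oracle CQR score under $P^0_{Y\mid X}$ is $S^\star(x,y)=\max\{f^0_{\alpha/2}(x)-y,\;y-f^0_{1-\alpha/2}(x)\}$ with $f^0_\tau$ the conditional quantiles of $P^0_{Y\mid X}$. Mass regularity of a kernel $P_{Y\mid X}$ on a set $\mathcal X_0$: there are constants $0<\mu_{\rm low}\le\mu_{\rm up}<\infty$ and $r_0>0$ such that for every $x\in\mathcal X_0$: $P_{Y\mid X=x}([u,v])\le\mu_{\rm up}(v-u)$ for all finite $u\le v$; and for $\tau\in\{\alpha/2,1-\alpha/2\}$, $0\le h\le r_0$, $P_{Y\mid X=x}([f_\tau(x)-h,f_\tau(x)])\ge\mu_{\rm low}h$ and $P_{Y\mid X=x}([f_\tau(x),f_\tau(x)+h])\ge\mu_{\rm low}h$. Admissible kernels: all conditional kernels $P_{Y\mid X}$ from $\mathcal X$ to $\mathbb R$ satisfying mass regularity on a measurable set of full $P_X$-measure. Threshold-vector rule: a measurable function $\widehat q_{1:K}=(\widehat q_1,\dots,\widehat q_K)$ of the $m$ source observations in $(\mathcal X\times\mathbb R)^m$ with values in $\overline{\mathbb R}^K$, $\overline{\mathbb R}=\mathbb R\cup\{\pm\infty\}$. Its canonical extension is $\widehat q(x)=\widehat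 q_k$ if $x=x_k$ for some $k$, and $\widehat q(x)=0$ if $x\notin\{x_1,\dots,x_K\}$. For a realized sample, $\mathrm{Cov}^P_{\{S^\star\le\widehat q\}}(x)=P_{Y\mid X=x}(\{y:S^\star(x,y)\le\widehat q(x)\})$. *)

theory Defs
  imports "HOL-Probability.Probability"
begin

text \<open>
  A conditional kernel from a measurable space X to the reals is a measurable map
  \<open>P \<in> X \<rightarrow>\<^sub>M prob_algebra borel\<close>; \<open>P x\<close> is the law of Y given \<open>X = x\<close>.
\<close>

text \<open>Valued in \<open>ennreal\<close>, so that a non-integrable square gives \<open>\<infinity>\<close> instead of 0.\<close>

definition chi_square_div :: "'a measure \<Rightarrow> 'a measure \<Rightarrow> ennreal" where
  "chi_square_div Q P = (\<integral>\<^sup>+ x. ennreal ((enn2real (RN_deriv P Q x) - 1)\<^sup>2) \<partial>P)"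

text \<open>For a probability measure \<open>P x\<close> and \<open>0 < \<tau> < 1\<close> the set below is nonempty and
  bounded below, so the real infimum is the true one.\<close>

definition cond_quantile :: "('a \<Rightarrow> real measure) \<Rightarrow> real \<Rightarrow> 'a \<Rightarrow> real" where
  "cond_quantile P \<tau> x = Inf {t. measure (P x) {..t} \<ge> \<tau>}"

definition cqr_score :: "real \<Rightarrow> ('a \<Rightarrow> real measure) \<Rightarrow> 'a \<Rightarrow> real \<Rightarrow> real" where
  "cqr_score \<alpha> P x y =
     max (cond_quantile P (\<alpha>/2) x - y) (y - cond_quantile P (1 - \<alpha>/2) x)"

definition mass_regular_on :: "real \<Rightarrow> ('a \<Rightarrow> real measure) \<Rightarrow> 'a set \<Rightarrow> bool" where
  "mass_regular_on \<alpha> P X0 \<longleftrightarrow>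
     (\<exists>\<mu>low \<mu>up r0. 0 < \<mu>low \<and> \<mu>low \<le> \<mu>up \<and> 0 < r0 \<and>
       (\<forall>x\<in>X0.
          (\<forall>u v. u \<le> v \<longrightarrow> measure (P x) {u..v} \<le> \<mu>up * (v - u)) \<and>
          (\<forall>\<tau>\<in>{\<alpha>/2, 1 - \<alpha>/2}. \<forall>h. 0 \<le> h \<and> h \<le> r0 \<longrightarrow>
             measure (P x) {cond_quantile P \<tau> x - h .. cond_quantile P \<tau> x} \<ge> \<mu>low * h \<and>
             measure (P x) {cond_quantile P \<tau> x .. cond_quantile P \<tau> x + h} \<ge> \<mu>low * h)))"

text \<open>The regularity constants may depend on the kernel.\<close>

definition admissible_kernels :: "real \<Rightarrow> 'a measure \<Rightarrow> ('a \<Rightarrow> real measure) set" where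
  "admissible_kernels \<alpha> PX =
     {P \<in> PX \<rightarrow>\<^sub>M prob_algebra borel.
        \<exists>X0\<in>sets PX. emeasure PX X0 = 1 \<and> mass_regular_on \<alpha> P X0}"

definition joint_law :: "'a measure \<Rightarrow> ('a \<Rightarrow> real measure) \<Rightarrow> ('a \<times> real) measure" where
  "joint_law PX P = PX \<bind> (\<lambda>x. distr (P x) (PX \<Otimes>\<^sub>M borel) (\<lambda>y. (x, y)))"

definition sample_law ::
    "nat \<Rightarrow> 'a measure \<Rightarrow> ('a \<Rightarrow> real measure) \<Rightarrow> (nat \<Rightarrow> 'a \<times> real) measure" where
  "sample_law m PX P = (\<Pi>\<^sub>M i\<in>{1..m}. joint_law PX P)"

definition threshold_rules ::
    "nat \<Rightarrow> nat \<Rightarrow> 'a measure \<Rightarrow> ((nat \<Rightarrow> 'a \<times> real) \<Rightarrow> nat \<Rightarrow> ereal) set" where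
  "threshold_rules m K X =
     (\<Pi>\<^sub>M i\<in>{1..m}. X \<Otimes>\<^sub>M borel) \<rightarrow>\<^sub>M (\<Pi>\<^sub>M k\<in>{1..K}. borel)"

definition canonical_ext ::
    "nat \<Rightarrow> (nat \<Rightarrow> 'a) \<Rightarrow> (nat \<Rightarrow> ereal) \<Rightarrow> 'a \<Rightarrow> ereal" where
  "canonical_ext K pts q x =
     (if x \<in> pts ` {1..K} then q (inv_into {1..K} pts x) else 0)"

definition coverage ::
    "('a \<Rightarrow> real measure) \<Rightarrow> ('a \<Rightarrow> real \<Rightarrow> real) \<Rightarrow> ('a \<Rightarrow> ereal) \<Rightarrow> 'a \<Rightarrow> real" where
  "coverage P S q x = measure (P x) {y. ereal (S x y) \<le> q x}"

text \<open>The exponent ranges over \<open>[1, \<infinity>]\<close>. The inner case distinction only extends the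
  real power \<open>t powr (1/p)\<close> to \<open>t = \<infinity>\<close>.\<close>

definition Lp_norm :: "ennreal \<Rightarrow> 'a measure \<Rightarrow> ('a \<Rightarrow> real) \<Rightarrow> ennreal" where
  "Lp_norm p M f =
     (if p = \<infinity> then esssup M (\<lambda>x. ennreal \<bar>f x\<bar>)
      else let I = (\<integral>\<^sup>+ x. ennreal (\<bar>f x\<bar> powr enn2real p) \<partial>M)
           in if I = \<infinity> then \<infinity> else ennreal (enn2real I powr (1 / enn2real p)))"

end

theory Submission
  imports Defs
begin

text \<open>
  The proof is a reduction to \<open>K\<close> simultaneous sign tests, in the manner of Assouad. The target is
  uniform on \<open>K\<close> points; the source gives each of them mass \<open>1 / ((1 + \<kappa>) K)\<close> and puts the
  rest on one further point, so only about \<open>m / ((1 + \<kappa>) K)\<close> observations inform about each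
  target point. The reference kernel is uniform on the unit interval at every point. Its oracle score
  is at most \<open>0\<close> exactly on the band from \<open>\<alpha>/2\<close> to \<open>1 - \<alpha>/2\<close>. For a sign at each target point, the
  perturbed kernel moves mass \<open>\<delta>\<close> into or out of this band, with
  \<open>\<delta> = sqrt ((1 + \<kappa>) \<alpha> (1 - \<alpha>) K / m) / 4\<close>. The condition on \<open>m\<close> gives
  \<open>\<delta> \<le> min \<alpha> (1 - \<alpha>) / 2\<close>, so all these kernels have densities in the interval from
  \<open>1/2\<close> to \<open>3/2\<close> and are admissible.

  A threshold can be right for only one of the two signs: if it is nonnegative, it overcovers by at
  least \<open>\<delta>\<close> under the positive sign, and if it is negative, it undercovers by at least
  \<open>\<delta>\<close> under the negative sign (\<open>coverage_error_wrong\<close>). If at least \<open>K/16\<close> of the points are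
  wrong in this sense, every norm of the coverage error is at least \<open>\<delta>/16\<close>
  (\<open>Lp_norm_target_lower_bound\<close>), which is the claimed rate.

  It remains to see that, for some sign pattern, fewer than \<open>K/16\<close> wrong points occur with
  probability at most \<open>exp (- K/32)\<close> (\<open>few_wrong_rare\<close>). The probabilities are averaged over all
  sign patterns and written as integrals of likelihood ratios under the reference sample. With
  exponential weights on the number of wrong points, the sum over patterns becomes a product over
  points of \<open>a/4 + b\<close>, where \<open>a\<close> and \<open>b\<close> are the likelihood ratios of the two signs at that
  point (\<open>averaged_likelihood_bound\<close>). This is at most a combination, with positive coefficients, of
  the constant \<open>1\<close> and of powers \<open>2\<close> and \<open>-1\<close> of the two ratios
  (\<open>posterior_error_bound\<close>). Such powers factorise over the observations, so the product over points
  can be expanded and integrated term by term, and the dependence between the numbers of observations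
  at different points never has to be analysed (\<open>tensor_moment_bound\<close>). The choice of
  \<open>\<delta>\<close> makes all powers integrate to nearly \<open>1\<close>, and the constants close in
  \<open>numeric_rate\<close>.
\<close>

section \<open>The uniform law and laws with density bounds\<close>

definition unif01 :: "real measure" where
  "unif01 = density lborel (indicator {0..1})"

lemma sets_unif01 [simp, measurable_cong]: "sets unif01 = sets borel"
  by (simp add: unif01_def)

lemma space_unif01 [simp]: "space unif01 = UNIV"
  by (simp add: unif01_def)

lemma emeasure_unif01:
  assumes "A \<in> sets borel"
  shows "emeasure unif01 A = emeasure lborel ({0..1} \<inter> A)"
proof -
  have "emeasure unif01 A = (\<integral>\<^sup>+ x. indicator {0..1} x * indicator A x \<partial>lborel)"
    unfolding unif01_def using assms by (subst emeasure_density) auto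
  also have "\<dots> = (\<integral>\<^sup>+ x. indicator ({0..1} \<inter> A) x \<partial>lborel)"
    by (intro nn_integral_cong) (auto simp: indicator_def)
  also have "\<dots> = emeasure lborel ({0..1} \<inter> A)"
    using assms by (intro nn_integral_indicator) auto
  finally show ?thesis .
qed

lemma prob_space_unif01: "prob_space unif01"
  by (rule prob_spaceI) (simp add: emeasure_unif01)

lemma unif01_kernel: "(\<lambda>_. unif01) \<in> X \<rightarrow>\<^sub>M prob_algebra borel"
  using prob_space_unif01 by (intro measurable_const) (simp add: space_prob_algebra)

lemma measure_unif01_interval:
  assumes "0 \<le> u" "u \<le> v" "v \<le> 1"
  shows "measure unif01 {u..v} = v - u"
proof -
  have "{0..1} \<inter> {u..v} = {u..v}" using assms by auto
  then have "emeasure unif01 {u..v} = ennreal (v - u)"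
    using assms by (simp add: emeasure_unif01)
  then show ?thesis using assms by (simp add: measure_def)
qed

lemma measure_unif01_interval_le:
  assumes "u \<le> v"
  shows "measure unif01 {u..v} \<le> v - u"
proof -
  have "emeasure unif01 {u..v} \<le> emeasure lborel {u..v}"
    by (simp add: emeasure_unif01) (intro emeasure_mono, auto)
  then have "emeasure unif01 {u..v} \<le> ennreal (v - u)"
    using assms by simp
  then show ?thesis using assms unfolding measure_def
    by (metis diff_ge_0_iff_ge enn2real_leI)
qed

text \<open>A two-sided density bound with respect to the uniform law, stated on events so that it
  does not mention a density.\<close>

definition uniform_like :: "real \<Rightarrow> real \<Rightarrow> real measure \<Rightarrow> bool" where
  "uniform_like c C \<nu> \<longleftrightarrow> prob_space \<nu> \<and> sets \<nu> = sets borel \<and>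
     (\<forall>A\<in>sets borel. c * measure unif01 A \<le> measure \<nu> A \<and> measure \<nu> A \<le> C * measure unif01 A)"

text \<open>The upper density bound gives \<open>F t \<le> C t\<close> and \<open>1 - F t \<le> C (1 - t)\<close> on the unit
  interval for the distribution function \<open>F\<close>, and these two inequalities keep the quantile away from the ends. In particular \<open>C = 1\<close> forces the quantile
  of the uniform law to be \<open>\<tau>\<close> itself.\<close>

lemma uniform_like_quantile:
  fixes P :: "'a \<Rightarrow> real measure"
  assumes "uniform_like c C (P x)" "0 < \<tau>" "\<tau> < 1"
  shows "\<tau> / C \<le> cond_quantile P \<tau> x" "cond_quantile P \<tau> x \<le> 1 - (1 - \<tau>) / C" "1 \<le> C"
proof -
  interpret U: prob_space unif01 by (rule prob_space_unif01)
  interpret N: prob_space "P x" using assms(1) by (simp add: uniform_like_def)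
  have s: "sets (P x) = sets borel" using assms(1) by (simp add: uniform_like_def)
  have sp: "space (P x) = UNIV" using sets_eq_imp_space_eq[OF s] by simp
  have up: "A \<in> sets borel \<Longrightarrow> measure (P x) A \<le> C * measure unif01 A" for A
    using assms(1) by (simp add: uniform_like_def)
  have "measure (P x) UNIV \<le> C * measure unif01 UNIV" by (rule up) simp
  then show C: "1 \<le> C"
    using N.prob_space U.prob_space by (simp add: sp)
  let ?T = "{t. measure (P x) {..t} \<ge> \<tau>}"
  \<comment> \<open>the point where the lower bound \<open>1 - C (1 - t)\<close> for the distribution function reaches \<open>\<tau>\<close>\<close>
  define t0 where "t0 = 1 - (1 - \<tau>) / C"
  have t0: "0 \<le> t0" "t0 \<le> 1" "C * (1 - t0) = 1 - \<tau>" using C assms(2,3)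
    by (auto simp: t0_def field_simps)
  have "measure (P x) {t0<..} \<le> C * measure unif01 {t0<..}" by (rule up) simp
  also have "measure unif01 {t0<..} = measure unif01 {t0..1}"
  proof -
    have "emeasure unif01 {t0<..} = ennreal (1 - t0)"
    proof -
      have "{0..1} \<inter> {t0<..} = {t0<..1}" using t0 by auto
      then show ?thesis using t0 by (simp add: emeasure_unif01)
    qed
    then show ?thesis using t0 by (simp add: measure_unif01_interval measure_def[of _ "{t0<..}"])
  qed
  also have "\<dots> = 1 - t0" using t0 by (simp add: measure_unif01_interval)
  finally have "measure (P x) {t0<..} \<le> 1 - \<tau>" using t0 by simp
  moreover have "measure (P x) {..t0} = 1 - measure (P x) {t0<..}"
    using N.prob_compl[of "{t0<..}"] by (simp add: s sp Compl_eq_Diff_UNIV[symmetric])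
  ultimately have mem: "t0 \<in> ?T" by simp
  have low: "\<tau> / C \<le> t" if "t \<in> ?T" for t
  proof -
    have "\<tau> \<le> measure (P x) {..t}" using that by simp
    also have "\<dots> \<le> C * measure unif01 {..t}" by (rule up) simp
    also have "measure unif01 {..t} \<le> measure unif01 {0..max 0 t}"
    proof -
      have "emeasure unif01 {..t} \<le> emeasure unif01 {0..max 0 t}"
        unfolding emeasure_unif01[OF borel_closed[OF closed_atMost]] emeasure_unif01[OF borel_closed[OF closed_atLeastAtMost]]
        by (intro emeasure_mono) auto
      then show ?thesis by (simp add: U.emeasure_eq_measure)
    qed
    also have "\<dots> \<le> max 0 t" using measure_unif01_interval_le[of 0 "max 0 t"] by simp
    finally have "\<tau> \<le> C * max 0 t" using C by simp
    then have "\<tau> \<le> C * t" using assms(2) C by (cases "t \<ge> 0") (auto simp: max_def)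
    then show ?thesis using C by (simp add: field_simps)
  qed
  show "\<tau> / C \<le> cond_quantile P \<tau> x"
    unfolding cond_quantile_def using mem low by (intro cInf_greatest) auto
  show "cond_quantile P \<tau> x \<le> 1 - (1 - \<tau>) / C"
    unfolding cond_quantile_def t0_def[symmetric] using mem low
    by (intro cInf_lower) (auto simp: bdd_below_def)
qed

text \<open>The previous bound puts every quantile in question at distance at least \<open>\<alpha> / (2 C)\<close> from
  both ends of the unit interval, so windows of that radius stay where the density is at least
  \<open>c\<close>.\<close>

lemma uniform_like_mass_regular:
  fixes P :: "'a \<Rightarrow> real measure"
  assumes "\<And>x. x \<in> X0 \<Longrightarrow> uniform_like c C (P x)" "0 < c" "c \<le> C" "0 < \<alpha>" "\<alpha> < 1"
  shows "mass_regular_on \<alpha> P X0"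
  unfolding mass_regular_on_def
proof (intro exI conjI ballI allI impI)
  show "0 < c" "c \<le> C" by fact+
  \<comment> \<open>the radius works for both levels because each of \<open>\<tau>\<close> and \<open>1 - \<tau>\<close> is at least \<open>\<alpha>/2\<close>\<close>
  show "0 < \<alpha> / 2 / C" using assms by auto
  fix x assume x: "x \<in> X0"
  note ul = assms(1)[OF x]
  show "measure (P x) {u..v} \<le> C * (v - u)" if "u \<le> v" for u v
  proof -
    have "measure (P x) {u..v} \<le> C * measure unif01 {u..v}"
      using ul by (simp add: uniform_like_def)
    also have "\<dots> \<le> C * (v - u)"
      using assms that by (intro mult_left_mono measure_unif01_interval_le) auto
    finally show ?thesis .
  qed
  fix \<tau> h :: real assume \<tau>: "\<tau> \<in> {\<alpha>/2, 1 - \<alpha>/2}" and h: "0 \<le> h \<and> h \<le> \<alpha> / 2 / C"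
  have \<tau>01: "0 < \<tau>" "\<tau> < 1" "\<alpha>/2 \<le> \<tau>" "\<alpha>/2 \<le> 1 - \<tau>" using \<tau> assms by auto
  note b = uniform_like_quantile[of c C P, OF ul \<tau>01(1,2)]
  let ?q = "cond_quantile P \<tau> x"
  have "h \<le> \<tau> / C" "h \<le> (1 - \<tau>) / C"
    using h \<tau>01 b(3) by (simp_all add: field_simps)
  then have q: "0 \<le> ?q - h" "?q + h \<le> 1" using b by auto
  have low: "c * h \<le> measure (P x) {u..u+h}" if "0 \<le> u" "u + h \<le> 1" for u
  proof -
    have "c * h = c * measure unif01 {u..u+h}" using that h by (simp add: measure_unif01_interval)
    also have "\<dots> \<le> measure (P x) {u..u+h}" using ul by (simp add: uniform_like_def)
    finally show ?thesis .
  qed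
  show "c * h \<le> measure (P x) {?q - h..?q}" using low[of "?q - h"] q h by simp
  show "c * h \<le> measure (P x) {?q..?q + h}" using low[of "?q"] q h by simp
qed

section \<open>Tilting the uniform law towards a central band\<close>

definition band :: "real \<Rightarrow> real set" where
  "band \<alpha> = {\<alpha>/2..1 - \<alpha>/2}"

text \<open>The direction of perturbation. It has mean zero under the uniform law, and it is constant on
  the band and off it, so it moves mass \<open>\<delta>\<close> into the band, which is the acceptance region of
  the oracle score at threshold \<open>0\<close>.\<close>

definition tilt_fn :: "real \<Rightarrow> real \<Rightarrow> real \<Rightarrow> real" where
  "tilt_fn \<alpha> \<delta> y = (if y \<in> band \<alpha> then \<delta> / (1 - \<alpha>) else - \<delta> / \<alpha>)"

definition tilted :: "real \<Rightarrow> real \<Rightarrow> real \<Rightarrow> real measure" where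
  "tilted \<alpha> \<delta> s = density unif01 (\<lambda>y. ennreal (1 + s * tilt_fn \<alpha> \<delta> y))"

lemma band_borel [measurable]: "band \<alpha> \<in> sets borel"
  by (simp add: band_def)

lemma tilt_fn_measurable [measurable]: "tilt_fn \<alpha> \<delta> \<in> borel_measurable borel"
  unfolding tilt_fn_def by measurable

lemma sets_tilted [simp, measurable_cong]: "sets (tilted \<alpha> \<delta> s) = sets borel"
  by (simp add: tilted_def)

lemma space_tilted [simp]: "space (tilted \<alpha> \<delta> s) = UNIV"
  by (simp add: tilted_def)

lemma tilted_0: "tilted \<alpha> \<delta> 0 = unif01"
  by (simp add: tilted_def density_1)

lemma nn_integral_unif01_band:
  assumes "0 < \<alpha>" "\<alpha> < 1" "0 \<le> a" "0 \<le> b"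
  shows "(\<integral>\<^sup>+ y. ennreal (if y \<in> band \<alpha> then a else b) \<partial>unif01) = ennreal ((1 - \<alpha>) * a + \<alpha> * b)"
proof -
  interpret U: prob_space unif01 by (rule prob_space_unif01)
  have m: "measure unif01 (band \<alpha>) = 1 - \<alpha>"
    using assms unfolding band_def by (subst measure_unif01_interval) auto
  then have m': "measure unif01 (- band \<alpha>) = \<alpha>"
    using U.prob_compl[of "band \<alpha>"] by (simp add: Compl_eq_Diff_UNIV)
  have "(\<integral>\<^sup>+ y. ennreal (if y \<in> band \<alpha> then a else b) \<partial>unif01)
      = (\<integral>\<^sup>+ y. ennreal a * indicator (band \<alpha>) y + ennreal b * indicator (- band \<alpha>) y \<partial>unif01)"
    by (intro nn_integral_cong) (auto simp: indicator_def)
  also have "\<dots> = ennreal a * emeasure unif01 (band \<alpha>) + ennreal b * emeasure unif01 (- band \<alpha>)"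
    by (subst nn_integral_add) (auto simp: nn_integral_cmult_indicator)
  also have "\<dots> = ennreal ((1 - \<alpha>) * a + \<alpha> * b)"
    using assms by (simp add: U.emeasure_eq_measure m m' ennreal_mult[symmetric] ennreal_plus[symmetric]
        mult.commute del: ennreal_plus)
  finally show ?thesis .
qed

context
  fixes \<alpha> \<delta> :: real
  assumes \<alpha>: "0 < \<alpha>" "\<alpha> < 1" and \<delta>: "0 \<le> \<delta>" "\<delta> \<le> min \<alpha> (1 - \<alpha>) / 2"
begin

lemma tilt_fn_values: "0 \<le> \<delta> / (1 - \<alpha>)" "\<delta> / (1 - \<alpha>) \<le> 1/2" "0 \<le> \<delta> / \<alpha>" "\<delta> / \<alpha> \<le> 1/2"
  using \<alpha> \<delta> by (auto simp: field_simps)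

lemma abs_tilt_fn: "\<bar>tilt_fn \<alpha> \<delta> y\<bar> \<le> 1/2"
  using tilt_fn_values
  by (cases "y \<in> band \<alpha>")
    (simp_all only: tilt_fn_def if_True if_False minus_divide_left[symmetric] abs_minus_cancel abs_of_nonneg)

lemma tilt_fn_inside: "tilt_fn \<alpha> \<delta> (1/2) = \<delta> / (1 - \<alpha>)"
  and tilt_fn_outside: "tilt_fn \<alpha> \<delta> 2 = - \<delta> / \<alpha>"
  using \<alpha> by (auto simp: tilt_fn_def band_def)

text \<open>Since \<open>\<delta> \<le> min \<alpha> (1 - \<alpha>) / 2\<close>, the tilt is at most \<open>1/2\<close> in absolute value.
  Admissibility of the perturbed laws and the control of inverse likelihood ratios both rest on
  this, and the lower bound on the sample size is what guarantees it.\<close>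

lemma tilt_density_bounds:
  assumes "\<bar>s\<bar> \<le> 1"
  shows "1/2 \<le> 1 + s * tilt_fn \<alpha> \<delta> y" "1 + s * tilt_fn \<alpha> \<delta> y \<le> 3/2"
proof -
  have "\<bar>s * tilt_fn \<alpha> \<delta> y\<bar> \<le> 1 * (1/2)"
    unfolding abs_mult using assms abs_tilt_fn by (intro mult_mono) auto
  then show "1/2 \<le> 1 + s * tilt_fn \<alpha> \<delta> y" "1 + s * tilt_fn \<alpha> \<delta> y \<le> 3/2" by linarith+
qed

lemma nn_integral_tilt:
  assumes "0 \<le> F (\<delta> / (1 - \<alpha>))" "0 \<le> F (- \<delta> / \<alpha>)"
  shows "(\<integral>\<^sup>+ y. ennreal (F (tilt_fn \<alpha> \<delta> y)) \<partial>unif01)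
    = ennreal ((1 - \<alpha>) * F (\<delta> / (1 - \<alpha>)) + \<alpha> * F (- \<delta> / \<alpha>))"
  using nn_integral_unif01_band[OF \<alpha> assms] by (simp add: tilt_fn_def if_distrib[of F])

lemma prob_space_tilted:
  assumes "\<bar>s\<bar> \<le> 1"
  shows "prob_space (tilted \<alpha> \<delta> s)"
proof (rule prob_spaceI)
  have "emeasure (tilted \<alpha> \<delta> s) UNIV = (\<integral>\<^sup>+ y. ennreal ((\<lambda>t. 1 + s * t) (tilt_fn \<alpha> \<delta> y)) \<partial>unif01)"
    unfolding tilted_def by (subst emeasure_density) auto
  also have "\<dots> = ennreal ((1 - \<alpha>) * (1 + s * (\<delta> / (1 - \<alpha>))) + \<alpha> * (1 + s * (- \<delta> / \<alpha>)))"
  proof (rule nn_integral_tilt)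
    show "0 \<le> 1 + s * (\<delta> / (1 - \<alpha>))" "0 \<le> 1 + s * (- \<delta> / \<alpha>)"
      using tilt_density_bounds(1)[OF assms, of "1/2"] tilt_density_bounds(1)[OF assms, of 2]
      unfolding tilt_fn_inside tilt_fn_outside by linarith+
  qed
  also have "(1 - \<alpha>) * (1 + s * (\<delta> / (1 - \<alpha>))) + \<alpha> * (1 + s * (- \<delta> / \<alpha>)) = 1"
    using \<alpha> by (simp add: field_simps)
  finally show "emeasure (tilted \<alpha> \<delta> s) (space (tilted \<alpha> \<delta> s)) = 1" by simp
qed

lemma uniform_like_tilted:
  assumes "\<bar>s\<bar> \<le> 1"
  shows "uniform_like (1/2) (3/2) (tilted \<alpha> \<delta> s)"
  unfolding uniform_like_def
proof (intro conjI ballI)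
  interpret U: prob_space unif01 by (rule prob_space_unif01)
  interpret N: prob_space "tilted \<alpha> \<delta> s" by (rule prob_space_tilted[OF assms])
  show "prob_space (tilted \<alpha> \<delta> s)" by (rule N.prob_space_axioms)
  show "sets (tilted \<alpha> \<delta> s) = sets borel" by simp
  fix A :: "real set" assume A [measurable]: "A \<in> sets borel"
  have eq: "emeasure (tilted \<alpha> \<delta> s) A = (\<integral>\<^sup>+ y. ennreal (1 + s * tilt_fn \<alpha> \<delta> y) * indicator A y \<partial>unif01)"
    unfolding tilted_def by (rule emeasure_density) auto
  have "ennreal (1/2) * emeasure unif01 A = (\<integral>\<^sup>+ y. ennreal (1/2) * indicator A y \<partial>unif01)"
    by (subst nn_integral_cmult_indicator) auto
  also have "\<dots> \<le> emeasure (tilted \<alpha> \<delta> s) A"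
    unfolding eq using tilt_density_bounds(1)[OF assms]
    by (intro nn_integral_mono mult_right_mono ennreal_leI) auto
  finally show "1/2 * U.prob A \<le> N.prob A"
    by (simp add: U.emeasure_eq_measure N.emeasure_eq_measure ennreal_mult'[symmetric] del: ennreal_half)
  have "emeasure (tilted \<alpha> \<delta> s) A \<le> (\<integral>\<^sup>+ y. ennreal (3/2) * indicator A y \<partial>unif01)"
    unfolding eq using tilt_density_bounds(2)[OF assms]
    by (intro nn_integral_mono mult_right_mono ennreal_leI) auto
  also have "\<dots> = ennreal (3/2) * emeasure unif01 A"
    by (subst nn_integral_cmult_indicator) auto
  finally show "N.prob A \<le> 3/2 * U.prob A"
    by (simp add: U.emeasure_eq_measure N.emeasure_eq_measure ennreal_mult'[symmetric])
qed

text \<open>The sign of the tilt decides on which side of \<open>1 - \<alpha>\<close> the coverage at threshold \<open>0\<close>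
  lies, and by how much.\<close>

lemma measure_tilted_band:
  assumes "\<bar>s\<bar> \<le> 1"
  shows "measure (tilted \<alpha> \<delta> s) (band \<alpha>) = 1 - \<alpha> + s * \<delta>"
proof -
  have pos: "0 \<le> 1 + s * (\<delta> / (1 - \<alpha>))"
    using tilt_density_bounds(1)[OF assms, of "1/2"] unfolding tilt_fn_inside by linarith
  have "emeasure (tilted \<alpha> \<delta> s) (band \<alpha>)
      = (\<integral>\<^sup>+ y. ennreal (1 + s * tilt_fn \<alpha> \<delta> y) * indicator (band \<alpha>) y \<partial>unif01)"
    unfolding tilted_def by (rule emeasure_density) auto
  also have "\<dots> = (\<integral>\<^sup>+ y. ennreal (if y \<in> band \<alpha> then 1 + s * (\<delta> / (1 - \<alpha>)) else 0) \<partial>unif01)"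
    by (intro nn_integral_cong) (auto simp: tilt_fn_def)
  also have "\<dots> = ennreal ((1 - \<alpha>) * (1 + s * (\<delta> / (1 - \<alpha>))) + \<alpha> * 0)"
    by (rule nn_integral_unif01_band[OF \<alpha> pos]) simp
  also have eq: "(1 - \<alpha>) * (1 + s * (\<delta> / (1 - \<alpha>))) + \<alpha> * 0 = 1 - \<alpha> + s * \<delta>"
    using \<alpha> by (simp add: field_simps)
  finally have "emeasure (tilted \<alpha> \<delta> s) (band \<alpha>) = ennreal (1 - \<alpha> + s * \<delta>)" .
  moreover have "0 \<le> 1 - \<alpha> + s * \<delta>"
  proof -
    have "0 \<le> (1 - \<alpha>) * (1 + s * (\<delta> / (1 - \<alpha>))) + \<alpha> * 0" using pos \<alpha> by simp
    then show ?thesis unfolding eq .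
  qed
  ultimately show ?thesis by (simp add: measure_def)
qed

text \<open>The linear term integrates to zero and the square of the tilt to
  \<open>\<delta>\<^sup>2 / (\<alpha> (1 - \<alpha>))\<close>, the information that one observation carries about the sign.\<close>

lemma mean_zero_quadratic:
  "(1 - \<alpha>) * (1 + s * (\<delta> / (1 - \<alpha>)) + r * (\<delta> / (1 - \<alpha>))\<^sup>2)
    + \<alpha> * (1 + s * (- \<delta> / \<alpha>) + r * (- \<delta> / \<alpha>)\<^sup>2) = 1 + r * (\<delta>\<^sup>2 / (\<alpha> * (1 - \<alpha>)))"
proof -
  define a b where "a = \<delta> / (1 - \<alpha>)" and "b = \<delta> / \<alpha>"
  have ab: "(1 - \<alpha>) * a = \<delta>" "\<alpha> * b = \<delta>" using \<alpha> by (auto simp: a_def b_def)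
  have "\<delta>\<^sup>2 / (\<alpha> * (1 - \<alpha>)) = \<delta> * a + \<delta> * b"
    using \<alpha> by (simp add: a_def b_def field_simps power2_eq_square)
  moreover have "(1 - \<alpha>) * (1 + s * a + r * a\<^sup>2) + \<alpha> * (1 + s * (- b) + r * (- b)\<^sup>2)
     = 1 + s * ((1 - \<alpha>) * a) - s * (\<alpha> * b) + r * (((1 - \<alpha>) * a) * a) + r * ((\<alpha> * b) * b)"
    by (simp add: algebra_simps power2_eq_square)
  ultimately show ?thesis unfolding ab
    by (simp add: a_def[symmetric] b_def[symmetric] algebra_simps)
qed

lemma second_moment_tilt:
  assumes "s = 1 \<or> s = -1"
  shows "(\<integral>\<^sup>+ y. ennreal ((1 + s * tilt_fn \<alpha> \<delta> y) powi 2) \<partial>unif01)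
    = ennreal (1 + \<delta>\<^sup>2 / (\<alpha> * (1 - \<alpha>)))"
proof -
  have sq: "(1 + s * t) powi 2 = 1 + (2 * s) * t + 1 * t\<^sup>2" for t
    using assms by (auto simp: power2_eq_square algebra_simps)
  have "(\<integral>\<^sup>+ y. ennreal ((\<lambda>t. 1 + (2 * s) * t + 1 * t\<^sup>2) (tilt_fn \<alpha> \<delta> y)) \<partial>unif01)
     = ennreal (1 + 1 * (\<delta>\<^sup>2 / (\<alpha> * (1 - \<alpha>))))"
    unfolding mean_zero_quadratic[of "2 * s" 1, symmetric]
    by (rule nn_integral_tilt) (simp_all only: sq[symmetric], simp_all)
  then show ?thesis by (simp only: sq) simp
qed

text \<open>From \<open>1 / (1 + t) \<le> 1 - t + 2 t\<^sup>2\<close> for \<open>\<bar>t\<bar> \<le> 1/2\<close>.\<close>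

lemma inverse_moment_tilt:
  assumes "s = 1 \<or> s = -1"
  shows "(\<integral>\<^sup>+ y. ennreal ((1 + s * tilt_fn \<alpha> \<delta> y) powi (-1)) \<partial>unif01)
    \<le> ennreal (1 + 2 * (\<delta>\<^sup>2 / (\<alpha> * (1 - \<alpha>))))"
proof -
  have b: "1 / (1 + t) \<le> 1 - t + 2 * t\<^sup>2" if "\<bar>t\<bar> \<le> 1/2" for t :: real
  proof -
    have "0 \<le> t\<^sup>2 * (1 + 2 * t)" using that by (intro mult_nonneg_nonneg) auto
    then have "1 \<le> (1 - t + 2 * t\<^sup>2) * (1 + t)"
      by (simp add: algebra_simps power2_eq_square)
    then show ?thesis using that by (subst pos_divide_le_eq) auto
  qed
  have s1: "\<bar>s\<bar> \<le> 1" "s * s = 1" using assms by auto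
  have "(\<integral>\<^sup>+ y. ennreal ((1 + s * tilt_fn \<alpha> \<delta> y) powi (-1)) \<partial>unif01)
     \<le> (\<integral>\<^sup>+ y. ennreal ((\<lambda>t. 1 + (- s) * t + 2 * t\<^sup>2) (tilt_fn \<alpha> \<delta> y)) \<partial>unif01)"
  proof (intro nn_integral_mono ennreal_leI)
    fix y
    have "\<bar>s * tilt_fn \<alpha> \<delta> y\<bar> \<le> 1/2" using abs_tilt_fn assms by (auto simp: abs_mult)
    from b[OF this] show "(1 + s * tilt_fn \<alpha> \<delta> y) powi (-1) \<le> 1 + (- s) * tilt_fn \<alpha> \<delta> y + 2 * (tilt_fn \<alpha> \<delta> y)\<^sup>2"
      using assms by (auto simp: power_mult_distrib power_int_minus divide_inverse)
  qed
  also have "\<dots> = ennreal ((1 - \<alpha>) * (1 + (- s) * (\<delta> / (1 - \<alpha>)) + 2 * (\<delta> / (1 - \<alpha>))\<^sup>2)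
        + \<alpha> * (1 + (- s) * (- \<delta> / \<alpha>) + 2 * (- \<delta> / \<alpha>)\<^sup>2))"
  proof (rule nn_integral_tilt)
    have "\<bar>s * (\<delta> / (1 - \<alpha>))\<bar> \<le> 1" "\<bar>s * (- \<delta> / \<alpha>)\<bar> \<le> 1" 
      using assms abs_tilt_fn[of "1/2"] abs_tilt_fn[of 2] unfolding tilt_fn_inside tilt_fn_outside abs_mult
      by (elim disjE; simp only: abs_one abs_minus_cancel mult_1; linarith)+
    then show "0 \<le> 1 + (- s) * (\<delta> / (1 - \<alpha>)) + 2 * (\<delta> / (1 - \<alpha>))\<^sup>2"
      "0 \<le> 1 + (- s) * (- \<delta> / \<alpha>) + 2 * (- \<delta> / \<alpha>)\<^sup>2"
      using zero_le_power2[of "\<delta> / (1 - \<alpha>)"] zero_le_power2[of "- \<delta> / \<alpha>"] by linarith+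
  qed
  also note mean_zero_quadratic
  finally show ?thesis .
qed

end

section \<open>Laws with finite support, joint laws and samples\<close>

text \<open>The points with index \<open>1, \<dots>, K\<close> will carry the target; the point with index \<open>0\<close> is a
  reservoir that absorbs the rest of the source mass.\<close>

locale support_points =
  fixes X :: "'a measure" and pts :: "nat \<Rightarrow> 'a" and K :: nat
  assumes inj_pts: "inj_on pts {0..K}"
    and pts_space: "\<And>j. j \<le> K \<Longrightarrow> pts j \<in> space X"
    and pts_sets: "\<And>j. j \<le> K \<Longrightarrow> {pts j} \<in> sets X"
    and K_pos: "1 \<le> K"
begin

definition mixture :: "(nat \<Rightarrow> real) \<Rightarrow> 'a measure" where
  "mixture w = distr (point_measure {0..K} (\<lambda>j. ennreal (w j))) X pts"

lemma sets_mixture [simp, measurable_cong]: "sets (mixture w) = sets X"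
  by (simp add: mixture_def)

lemma space_mixture [simp]: "space (mixture w) = space X"
  by (simp add: mixture_def)

lemma pts_measurable: "pts \<in> point_measure {0..K} f \<rightarrow>\<^sub>M X"
  using pts_space by simp

lemma image_pts_sets: "J \<subseteq> {0..K} \<Longrightarrow> pts ` J \<in> sets X"
proof -
  assume J: "J \<subseteq> {0..K}"
  have "finite J" using J finite_subset by blast
  moreover have "(\<Union>j\<in>J. {pts j}) \<in> sets X" using J pts_sets calculation by (intro sets.finite_UN) auto
  ultimately show ?thesis by (simp add: UNION_singleton_eq_range)
qed

text \<open>Finitely supported laws are insensitive to what happens off their support, even for
  properties and functions that are not measurable. This lets integrals be computed for arbitrary
  functions below.\<close>

lemma AE_mixture: "(AE x in mixture w. P x) \<longleftrightarrow> (\<forall>j\<le>K. 0 < w j \<longrightarrow> P (pts j))"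
proof
  assume "AE x in mixture w. P x"
  then have "AE j in point_measure {0..K} (\<lambda>j. ennreal (w j)). P (pts j)"
    unfolding mixture_def by (rule AE_distrD[OF pts_measurable])
  then show "\<forall>j\<le>K. 0 < w j \<longrightarrow> P (pts j)"
    by (auto simp: AE_point_measure)
next
  assume P: "\<forall>j\<le>K. 0 < w j \<longrightarrow> P (pts j)"
  let ?S = "pts ` {j \<in> {0..K}. 0 < w j}"
  have S: "?S \<in> sets X" by (rule image_pts_sets) auto
  have "AE x in mixture w. x \<in> ?S"
    unfolding mixture_def
  proof (subst AE_distr_iff[OF pts_measurable])
    have "{x \<in> space X. x \<in> ?S} = ?S" using pts_space by auto
    then show "{x \<in> space X. x \<in> ?S} \<in> sets X" using S by simp
    show "AE j in point_measure {0..K} (\<lambda>j. ennreal (w j)). pts j \<in> ?S"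
      by (auto simp: AE_point_measure)
  qed
  then show "AE x in mixture w. P x"
    by eventually_elim (use P in auto)
qed

lemma measurable_off_points:
  assumes "f \<in> X \<rightarrow>\<^sub>M N" "\<And>x. x \<in> space X \<Longrightarrow> x \<notin> pts ` {0..K} \<Longrightarrow> g x = f x"
    "\<And>j. j \<le> K \<Longrightarrow> g (pts j) \<in> space N"
  shows "g \<in> X \<rightarrow>\<^sub>M N"
  by (rule measurable_discrete_difference[OF assms(1), of "pts ` {0..K}"])
    (use assms pts_sets in auto)

lemma nn_integral_mixture:
  "(\<integral>\<^sup>+ x. f x \<partial>mixture w) = (\<Sum>j=0..K. ennreal (w j) * f (pts j))"
proof -
  \<comment> \<open>a measurable representative of the arbitrary function \<open>f\<close>\<close>
  define g where "g x = (if x \<in> pts ` {0..K} then f x else 0)" for x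
  have g: "g \<in> borel_measurable X"
    by (rule measurable_off_points[of "\<lambda>_. 0"]) (auto simp: g_def)
  have "(\<integral>\<^sup>+ x. f x \<partial>mixture w) = (\<integral>\<^sup>+ x. g x \<partial>mixture w)"
    by (rule nn_integral_cong_AE) (auto simp: AE_mixture g_def)
  also have "\<dots> = (\<integral>\<^sup>+ j. g (pts j) \<partial>point_measure {0..K} (\<lambda>j. ennreal (w j)))"
    unfolding mixture_def by (rule nn_integral_distr[OF pts_measurable]) (use g in simp)
  also have "\<dots> = (\<Sum>j=0..K. ennreal (w j) * g (pts j))"
    by (simp add: nn_integral_point_measure_finite)
  also have "\<dots> = (\<Sum>j=0..K. ennreal (w j) * f (pts j))"
    by (intro sum.cong) (auto simp: g_def)
  finally show ?thesis .
qed

lemma emeasure_mixture: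
  assumes "A \<in> sets X"
  shows "emeasure (mixture w) A = (\<Sum>j=0..K. ennreal (w j) * indicator A (pts j))"
  using nn_integral_mixture[where f = "indicator A" and w = w] assms by simp

lemma prob_space_mixture:
  assumes "\<And>j. 0 \<le> w j" "(\<Sum>j=0..K. w j) = 1"
  shows "prob_space (mixture w)"
proof (rule prob_spaceI)
  have "emeasure (mixture w) (space X) = (\<Sum>j=0..K. ennreal (w j))"
    using pts_space by (subst emeasure_mixture) (auto intro!: sum.cong)
  also have "\<dots> = 1" using assms by simp
  finally show "emeasure (mixture w) (space (mixture w)) = 1" by simp
qed

end

lemma kernel_pair_measurable:
  assumes "sets PX = sets X" "P \<in> X \<rightarrow>\<^sub>M prob_algebra borel"
  shows "(\<lambda>x. distr (P x) (PX \<Otimes>\<^sub>M borel) (\<lambda>y. (x, y))) \<in> PX \<rightarrow>\<^sub>M subprob_algebra (PX \<Otimes>\<^sub>M borel)"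
proof -
  have m: "P \<in> PX \<rightarrow>\<^sub>M subprob_algebra borel"
    using measurable_prob_algebraD[OF assms(2)] assms(1) measurable_cong_sets by blast
  show ?thesis by (rule measurable_distr2[OF _ m]) measurable
qed

lemma sets_joint_law:
  assumes "sets PX = sets X" "P \<in> X \<rightarrow>\<^sub>M prob_algebra borel" "space X \<noteq> {}"
  shows "sets (joint_law PX P) = sets (X \<Otimes>\<^sub>M borel)"
proof -
  have "space PX \<noteq> {}" using assms sets_eq_imp_space_eq[OF assms(1)] by simp
  then have "sets (joint_law PX P) = sets (PX \<Otimes>\<^sub>M borel)"
    unfolding joint_law_def by (intro sets_bind) auto
  also have "\<dots> = sets (X \<Otimes>\<^sub>M borel)" using assms(1) by (intro sets_pair_measure_cong) auto
  finally show ?thesis .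
qed

lemma nn_integral_joint_law:
  assumes "sets PX = sets X" "P \<in> X \<rightarrow>\<^sub>M prob_algebra borel"
    and f: "f \<in> borel_measurable (X \<Otimes>\<^sub>M borel)"
  shows "(\<integral>\<^sup>+ z. f z \<partial>joint_law PX P) = (\<integral>\<^sup>+ x. \<integral>\<^sup>+ y. f (x, y) \<partial>P x \<partial>PX)"
proof -
  have f': "f \<in> borel_measurable (PX \<Otimes>\<^sub>M borel)"
    using f assms(1) measurable_cong_sets[OF sets_pair_measure_cong[OF assms(1) refl] refl] by blast
  have "(\<integral>\<^sup>+ z. f z \<partial>joint_law PX P)
     = (\<integral>\<^sup>+ x. \<integral>\<^sup>+ z. f z \<partial>distr (P x) (PX \<Otimes>\<^sub>M borel) (\<lambda>y. (x, y)) \<partial>PX)"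
    unfolding joint_law_def by (rule nn_integral_bind[OF f' kernel_pair_measurable[OF assms(1,2)]])
  also have "\<dots> = (\<integral>\<^sup>+ x. \<integral>\<^sup>+ y. f (x, y) \<partial>P x \<partial>PX)"
  proof (intro nn_integral_cong nn_integral_distr)
    show "f \<in> borel_measurable (distr (P x) (PX \<Otimes>\<^sub>M borel) (Pair x))" for x
      using f' by simp
    fix x assume x: "x \<in> space PX"
    then have "x \<in> space X" using sets_eq_imp_space_eq[OF assms(1)] by simp
    then have "sets (P x) = sets borel"
      using assms(2) by (auto simp: space_prob_algebra dest: measurable_space)
    then show "Pair x \<in> P x \<rightarrow>\<^sub>M PX \<Otimes>\<^sub>M borel"
      using x by (subst measurable_cong_sets[OF _ refl]) auto
  qed
  finally show ?thesis .
qed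

lemma prob_space_joint_law:
  assumes "prob_space PX" "sets PX = sets X" "P \<in> X \<rightarrow>\<^sub>M prob_algebra borel"
  shows "prob_space (joint_law PX P)"
proof (rule prob_spaceI)
  interpret PX: prob_space PX by fact
  have sp: "space X = space PX" using sets_eq_imp_space_eq[OF assms(2)] by simp
  have ne: "space X \<noteq> {}" using PX.not_empty sp by simp
  have "space (joint_law PX P) = space (X \<Otimes>\<^sub>M borel)"
    using sets_eq_imp_space_eq[OF sets_joint_law[OF assms(2,3) ne]] .
  then have "emeasure (joint_law PX P) (space (joint_law PX P))
    = (\<integral>\<^sup>+ z. indicator (space (X \<Otimes>\<^sub>M borel)) z \<partial>joint_law PX P)"
    using sets_joint_law[OF assms(2,3) ne] by simp
  also have "\<dots> = (\<integral>\<^sup>+ x. \<integral>\<^sup>+ y. indicator (space (X \<Otimes>\<^sub>M borel)) (x, y) \<partial>P x \<partial>PX)"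
    by (rule nn_integral_joint_law[OF assms(2,3)]) auto
  also have "\<dots> = (\<integral>\<^sup>+ x. 1 \<partial>PX)"
  proof (intro nn_integral_cong)
    fix x assume "x \<in> space PX"
    then have x: "x \<in> space X" using sp by simp
    then have "prob_space (P x)"
      using assms(3) by (auto simp: space_prob_algebra dest: measurable_space)
    moreover have "(\<integral>\<^sup>+ y. indicator (space (X \<Otimes>\<^sub>M borel)) (x, y) \<partial>P x) = (\<integral>\<^sup>+ y. 1 \<partial>P x)"
      using x by (intro nn_integral_cong) (auto simp: space_pair_measure indicator_def)
    ultimately show "(\<integral>\<^sup>+ y. indicator (space (X \<Otimes>\<^sub>M borel)) (x, y) \<partial>P x) = 1"
      by (simp add: prob_space.emeasure_space_1)
  qed
  also have "\<dots> = 1" by (simp add: PX.emeasure_space_1)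
  finally show "emeasure (joint_law PX P) (space (joint_law PX P)) = 1" .
qed

text \<open>Changing only the conditional law of \<open>Y\<close> multiplies the joint law by the conditional
  density.\<close>

lemma density_joint_law:
  assumes PX: "sets PX = sets X" "space X \<noteq> {}"
    and P: "P \<in> X \<rightarrow>\<^sub>M prob_algebra borel" "P' \<in> X \<rightarrow>\<^sub>M prob_algebra borel"
    and g: "g \<in> borel_measurable (X \<Otimes>\<^sub>M borel)"
    and eq: "\<And>x. x \<in> space X \<Longrightarrow> P' x = density (P x) (\<lambda>y. g (x, y))"
  shows "density (joint_law PX P) g = joint_law PX P'"
proof (rule measure_eqI)
  show "sets (density (joint_law PX P) g) = sets (joint_law PX P')"
    by (simp add: sets_joint_law[OF PX(1) P(1) PX(2)] sets_joint_law[OF PX(1) P(2) PX(2)])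
  fix A assume "A \<in> sets (density (joint_law PX P) g)"
  then have A [measurable]: "A \<in> sets (X \<Otimes>\<^sub>M borel)"
    by (simp add: sets_joint_law[OF PX(1) P(1) PX(2)])
  note g [measurable]
  have g': "g \<in> borel_measurable (joint_law PX P)"
    using g measurable_cong_sets[OF sets_joint_law[OF PX(1) P(1) PX(2)] refl] by blast
  have "emeasure (density (joint_law PX P) g) A = (\<integral>\<^sup>+ z. g z * indicator A z \<partial>joint_law PX P)"
    using A by (intro emeasure_density g') (simp add: sets_joint_law[OF PX(1) P(1) PX(2)])
  also have "\<dots> = (\<integral>\<^sup>+ x. \<integral>\<^sup>+ y. g (x, y) * indicator A (x, y) \<partial>P x \<partial>PX)"
    by (rule nn_integral_joint_law[OF PX(1) P(1)]) measurable
  also have "\<dots> = (\<integral>\<^sup>+ x. \<integral>\<^sup>+ y. indicator A (x, y) \<partial>P' x \<partial>PX)"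
  proof (intro nn_integral_cong)
    fix x assume "x \<in> space PX"
    then have x [measurable]: "x \<in> space X" using sets_eq_imp_space_eq[OF PX(1)] by simp
    have [measurable_cong]: "sets (P x) = sets borel"
      using P(1) x by (auto simp: space_prob_algebra dest: measurable_space)
    show "(\<integral>\<^sup>+ y. g (x, y) * indicator A (x, y) \<partial>P x) = (\<integral>\<^sup>+ y. indicator A (x, y) \<partial>P' x)"
      unfolding eq[OF x] by (subst nn_integral_density) measurable
  qed
  also have "\<dots> = (\<integral>\<^sup>+ z. indicator A z \<partial>joint_law PX P')"
    by (rule nn_integral_joint_law[OF PX(1) P(2), symmetric]) measurable
  also have "\<dots> = emeasure (joint_law PX P') A"
    using A by (simp add: sets_joint_law[OF PX(1) P(2) PX(2)])
  finally show "emeasure (density (joint_law PX P) g) A = emeasure (joint_law PX P') A" .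
qed

lemma density_PiM:
  assumes "finite I" "prob_space J" "prob_space (density J g)" and g [measurable]: "g \<in> borel_measurable J"
  shows "density (\<Pi>\<^sub>M i\<in>I. J) (\<lambda>\<omega>. \<Prod>i\<in>I. g (\<omega> i)) = (\<Pi>\<^sub>M i\<in>I. density J g)"
proof -
  interpret J: prob_space J by fact
  interpret D: prob_space "density J g" by fact
  interpret PJ: product_sigma_finite "\<lambda>_. J" by standard
  interpret PD: product_sigma_finite "\<lambda>_. density J g" by standard
  show ?thesis
  proof (rule PD.PiM_eqI)
    show "finite I" by fact
    show "sets (density (\<Pi>\<^sub>M i\<in>I. J) (\<lambda>\<omega>. \<Prod>i\<in>I. g (\<omega> i))) = sets (\<Pi>\<^sub>M i\<in>I. density J g)"
      by (simp cong: sets_PiM_cong)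
    fix A assume A: "\<And>i. i \<in> I \<Longrightarrow> A i \<in> sets (density J g)"
    then have A' [measurable]: "\<And>i. i \<in> I \<Longrightarrow> A i \<in> sets J" by simp
    have AI [measurable]: "Pi\<^sub>E I A \<in> sets (\<Pi>\<^sub>M i\<in>I. J)" using \<open>finite I\<close> A' by (intro sets_PiM_I_finite) auto
    have "emeasure (density (\<Pi>\<^sub>M i\<in>I. J) (\<lambda>\<omega>. \<Prod>i\<in>I. g (\<omega> i))) (Pi\<^sub>E I A)
        = (\<integral>\<^sup>+ \<omega>. (\<Prod>i\<in>I. g (\<omega> i)) * indicator (Pi\<^sub>E I A) \<omega> \<partial>(\<Pi>\<^sub>M i\<in>I. J))"
      by (rule emeasure_density) measurable
    also have "\<dots> = (\<integral>\<^sup>+ \<omega>. (\<Prod>i\<in>I. g (\<omega> i) * indicator (A i) (\<omega> i)) \<partial>(\<Pi>\<^sub>M i\<in>I. J))"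
    proof (intro nn_integral_cong)
      fix \<omega> assume "\<omega> \<in> space (\<Pi>\<^sub>M i\<in>I. J)"
      then have "(indicator (Pi\<^sub>E I A) \<omega> :: ennreal) = (\<Prod>i\<in>I. indicator (A i) (\<omega> i))"
        using \<open>finite I\<close> by (auto simp: indicator_def space_PiM PiE_iff prod_zero_iff[OF \<open>finite I\<close>])
      then show "(\<Prod>i\<in>I. g (\<omega> i)) * indicator (Pi\<^sub>E I A) \<omega> = (\<Prod>i\<in>I. g (\<omega> i) * indicator (A i) (\<omega> i))"
        by (simp add: prod.distrib)
    qed
    also have "\<dots> = (\<Prod>i\<in>I. \<integral>\<^sup>+ z. g z * indicator (A i) z \<partial>J)"
      by (rule PJ.product_nn_integral_prod[OF \<open>finite I\<close>]) measurable
    also have "\<dots> = (\<Prod>i\<in>I. emeasure (density J g) (A i))"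
      by (intro prod.cong refl emeasure_density[symmetric] g A')
    finally show "emeasure (density (\<Pi>\<^sub>M i\<in>I. J) (\<lambda>\<omega>. \<Prod>i\<in>I. g (\<omega> i))) (Pi\<^sub>E I A)
        = (\<Prod>i\<in>I. emeasure (density J g) (A i))" .
  qed
qed

section \<open>Integrating products of site-wise majorants\<close>

text \<open>This replaces conditioning on how many observations fall on each point. If every factor of a
  product over sites is a nonnegative combination of functions that factorise over the
  observations, then so is the product over sites once expanded; each term integrates to the
  \<open>card I\<close>-th power of a single-observation moment, and an exponential bound on those moments
  factorises back over the sites. Nonnegative coefficients are essential, since only upper bounds
  for the moments are available.\<close>

lemma tensor_moment_bound:
  fixes h :: "nat \<Rightarrow> 'l \<Rightarrow> 'z \<Rightarrow> real" and c e :: "'l \<Rightarrow> real"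
  assumes fin: "finite I" "finite N" "finite \<Lambda>" and J: "prob_space J"
    and c: "\<And>l. l \<in> \<Lambda> \<Longrightarrow> 0 \<le> c l"
    and h: "\<And>k l z. k \<in> N \<Longrightarrow> l \<in> \<Lambda> \<Longrightarrow> 0 \<le> h k l z"
      "\<And>k l. k \<in> N \<Longrightarrow> l \<in> \<Lambda> \<Longrightarrow> h k l \<in> borel_measurable J"
    and moment: "\<And>\<phi>. \<phi> \<in> N \<rightarrow>\<^sub>E \<Lambda> \<Longrightarrow>
      (\<integral>\<^sup>+ z. ennreal (\<Prod>k\<in>N. h k (\<phi> k) z) \<partial>J) \<le> ennreal (exp (\<Sum>k\<in>N. e (\<phi> k)))"
  shows "(\<integral>\<^sup>+ \<omega>. ennreal (\<Prod>k\<in>N. \<Sum>l\<in>\<Lambda>. c l * (\<Prod>i\<in>I. h k l (\<omega> i))) \<partial>(\<Pi>\<^sub>M i\<in>I. J))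
    \<le> ennreal ((\<Sum>l\<in>\<Lambda>. c l * exp (real (card I) * e l)) ^ card N)"
proof -
  interpret J: prob_space J by fact
  interpret PJ: product_sigma_finite "\<lambda>_. J" by standard
  let ?C = "\<lambda>\<phi>. \<Prod>k\<in>N. c (\<phi> k)"
  let ?H = "\<lambda>\<phi> z. \<Prod>k\<in>N. h k (\<phi> k) z"
  have mem: "\<phi> k \<in> \<Lambda>" if "\<phi> \<in> N \<rightarrow>\<^sub>E \<Lambda>" "k \<in> N" for \<phi> k using that by auto
  have C: "0 \<le> ?C \<phi>" if "\<phi> \<in> N \<rightarrow>\<^sub>E \<Lambda>" for \<phi> using c mem[OF that] by (intro prod_nonneg) auto
  have H: "0 \<le> ?H \<phi> z" if "\<phi> \<in> N \<rightarrow>\<^sub>E \<Lambda>" for \<phi> z using h mem[OF that] by (intro prod_nonneg) auto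
  have Hm: "?H \<phi> \<in> borel_measurable J" if "\<phi> \<in> N \<rightarrow>\<^sub>E \<Lambda>" for \<phi>
    using h(2) mem[OF that] by (intro borel_measurable_prod) auto
  have expand: "ennreal (\<Prod>k\<in>N. \<Sum>l\<in>\<Lambda>. c l * (\<Prod>i\<in>I. h k l (\<omega> i)))
     = (\<Sum>\<phi>\<in>N \<rightarrow>\<^sub>E \<Lambda>. ennreal (?C \<phi>) * (\<Prod>i\<in>I. ennreal (?H \<phi> (\<omega> i))))" for \<omega>
  proof -
    have "(\<Prod>k\<in>N. \<Sum>l\<in>\<Lambda>. c l * (\<Prod>i\<in>I. h k l (\<omega> i)))
       = (\<Sum>\<phi>\<in>N \<rightarrow>\<^sub>E \<Lambda>. \<Prod>k\<in>N. c (\<phi> k) * (\<Prod>i\<in>I. h k (\<phi> k) (\<omega> i)))"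
      using fin by (intro prod_sum_PiE) auto
    also have "\<dots> = (\<Sum>\<phi>\<in>N \<rightarrow>\<^sub>E \<Lambda>. ?C \<phi> * (\<Prod>i\<in>I. ?H \<phi> (\<omega> i)))"
      by (intro sum.cong refl) (simp add: prod.distrib prod.swap[of _ N I])
    finally show ?thesis
      using C H by (simp add: sum_ennreal[symmetric] prod_nonneg ennreal_mult prod_ennreal)
  qed
  have "(\<integral>\<^sup>+ \<omega>. ennreal (\<Prod>k\<in>N. \<Sum>l\<in>\<Lambda>. c l * (\<Prod>i\<in>I. h k l (\<omega> i))) \<partial>(\<Pi>\<^sub>M i\<in>I. J))
     = (\<Sum>\<phi>\<in>N \<rightarrow>\<^sub>E \<Lambda>. \<integral>\<^sup>+ \<omega>. ennreal (?C \<phi>) * (\<Prod>i\<in>I. ennreal (?H \<phi> (\<omega> i))) \<partial>(\<Pi>\<^sub>M i\<in>I. J))"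
    unfolding expand
  proof (rule nn_integral_sum)
    fix \<phi> assume l: "\<phi> \<in> N \<rightarrow>\<^sub>E \<Lambda>"
    note Hm[OF l, measurable]
    show "(\<lambda>\<omega>. ennreal (?C \<phi>) * (\<Prod>i\<in>I. ennreal (?H \<phi> (\<omega> i)))) \<in> borel_measurable (\<Pi>\<^sub>M i\<in>I. J)"
      by measurable
  qed
  also have "\<dots> \<le> (\<Sum>\<phi>\<in>N \<rightarrow>\<^sub>E \<Lambda>. ennreal (?C \<phi> * (\<Prod>k\<in>N. exp (real (card I) * e (\<phi> k)))))"
  proof (rule sum_mono)
    fix \<phi> assume l: "\<phi> \<in> N \<rightarrow>\<^sub>E \<Lambda>"
    note Hm[OF l, measurable]
    have "(\<integral>\<^sup>+ \<omega>. ennreal (?C \<phi>) * (\<Prod>i\<in>I. ennreal (?H \<phi> (\<omega> i))) \<partial>(\<Pi>\<^sub>M i\<in>I. J))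
       = ennreal (?C \<phi>) * (\<integral>\<^sup>+ \<omega>. (\<Prod>i\<in>I. ennreal (?H \<phi> (\<omega> i))) \<partial>(\<Pi>\<^sub>M i\<in>I. J))"
      by (rule nn_integral_cmult) measurable
    also have "(\<integral>\<^sup>+ \<omega>. (\<Prod>i\<in>I. ennreal (?H \<phi> (\<omega> i))) \<partial>(\<Pi>\<^sub>M i\<in>I. J))
       = (\<Prod>i\<in>I. \<integral>\<^sup>+ z. ennreal (?H \<phi> z) \<partial>J)"
      using fin by (intro PJ.product_nn_integral_prod) auto
    also have "\<dots> \<le> ennreal (exp (\<Sum>k\<in>N. e (\<phi> k))) ^ card I"
      unfolding prod_constant by (rule power_mono_ennreal[OF moment[OF l]])
    also have "\<dots> = ennreal (\<Prod>k\<in>N. exp (real (card I) * e (\<phi> k)))"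
      using fin by (simp add: ennreal_power exp_of_nat_mult[symmetric] exp_sum[symmetric] sum_distrib_left)
    finally show "(\<integral>\<^sup>+ \<omega>. ennreal (?C \<phi>) * (\<Prod>i\<in>I. ennreal (?H \<phi> (\<omega> i))) \<partial>(\<Pi>\<^sub>M i\<in>I. J))
       \<le> ennreal (?C \<phi> * (\<Prod>k\<in>N. exp (real (card I) * e (\<phi> k))))"
      using C[OF l] by (simp add: ennreal_mult prod_nonneg mult_left_mono)
  qed
  also have "\<dots> = ennreal (\<Sum>\<phi>\<in>N \<rightarrow>\<^sub>E \<Lambda>. \<Prod>k\<in>N. c (\<phi> k) * exp (real (card I) * e (\<phi> k)))"
    using C by (subst sum_ennreal) (auto simp: prod.distrib prod_nonneg)
  also have "(\<Sum>\<phi>\<in>N \<rightarrow>\<^sub>E \<Lambda>. \<Prod>k\<in>N. c (\<phi> k) * exp (real (card I) * e (\<phi> k)))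
     = (\<Prod>k\<in>N. \<Sum>l\<in>\<Lambda>. c l * exp (real (card I) * e l))"
    using fin by (intro prod_sum_PiE[symmetric]) auto
  finally show ?thesis by simp
qed

text \<open>A pair \<open>(e, s)\<close> stands for the \<open>e\<close>-th power of the likelihood ratio of one site under
  the sign \<open>s\<close>. The exponents \<open>0\<close>, \<open>2\<close> and \<open>-1\<close> are those on the right-hand side of
  the inequality \<open>posterior_error_bound\<close> below; the cost of a monomial bounds its
  expected growth per unit of information.\<close>

definition monomials :: "(int \<times> real) set" where
  "monomials = {(0, 1), (2, 1), (2, -1), (-1, 1), (-1, -1)}"

definition monomial_coeff :: "int \<times> real \<Rightarrow> real" where
  "monomial_coeff l = (if fst l = 0 then 1/4 else if fst l = 2 then 1/2 else 3/16)"

definition monomial_cost :: "int \<times> real \<Rightarrow> real" where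
  "monomial_cost l = (if fst l = 0 then 0 else if fst l = 2 then 1 else 2)"

lemma finite_monomials: "finite monomials"
  by (simp add: monomials_def)

text \<open>Here \<open>a\<close> and \<open>b\<close> are the two likelihood ratios of a site, \<open>a\<close> belonging to the sign
  whose event counts as a wrong decision and therefore carrying the weight \<open>1/4\<close>. At
  \<open>a = b = 1\<close> the right-hand side is \<open>13/8\<close>; that it is below \<open>2\<close>, the
  number of signs averaged over, is the source of the exponential decay in \<open>K\<close>. When \<open>a/4 + b\<close>
  is written as \<open>a + b - 3a/4\<close>, the inequality \<open>a + 1/(4a) \<ge> 1\<close> bounds the subtracted term, and \<open>x \<le> 1/2 + x\<^sup>2/2\<close> supplies enough constant to leave every coefficient
  positive, as required by \<open>tensor_moment_bound\<close>. The term with \<open>inverse b\<close> makes the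
  bound symmetric, hence independent of which sign the rule decides for.\<close>

lemma posterior_error_bound:
  fixes a b :: real
  assumes "0 < a" "0 < b"
  shows "a / 4 + b \<le> 1/4 + (a\<^sup>2 + b\<^sup>2) / 2 + 3/16 * (inverse a + inverse b)"
proof -
  have sq: "x \<le> 1/2 + x\<^sup>2 / 2" for x :: real
    using zero_le_power2[of "x - 1"] by (simp add: power2_diff)
  have "1 \<le> a + inverse a / 4"
  proof -
    have "0 \<le> (2 * a - 1)\<^sup>2 / (4 * a)" using assms by simp
    also have "\<dots> = a + inverse a / 4 - 1" using assms by (simp add: field_simps power2_eq_square)
    finally show ?thesis by simp
  qed
  moreover have "0 \<le> inverse b" using assms by simp
  moreover have "a / 4 + b \<le> 1/4 + (A + B) / 2 + 3/16 * (p + q)"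
    if "1 \<le> a + p / 4" "0 \<le> q" "a \<le> 1/2 + A / 2" "b \<le> 1/2 + B / 2" for A B p q :: real
    using that by argo
  ultimately show ?thesis using sq[of a] sq[of b] by blast
qed

text \<open>The numerical slack that closes the argument: per site, the factor \<open>2 powr (1/8)\<close> is paid to
  pass from the event that fewer than \<open>K/16\<close> decisions are wrong to exponential weights, the
  bracket is the integrated majorant, and the factor \<open>2\<close> on the right counts the two
  signs.\<close>

lemma numeric_rate:
  "2 powr (1/8) * (1/4 + exp (1/16) + 3/8 * exp (1/8)) \<le> 2 * exp (-1/32::real)"
proof -
  have "(2::real) powr (1/8) \<le> 1.091"
  proof -
    have "((2::real) powr (1/8)) ^ 8 = 2" by (simp add: powr_power)
    also have "(2::real) \<le> (1091 / 1000) ^ 8" by (simp add: power_divide)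
    finally have "((2::real) powr (1/8)) ^ 8 \<le> (1091 / 1000) ^ 8" .
    then have "(2::real) powr (1/8) \<le> 1091 / 1000" by (subst (asm) power_mono_iff) auto
    then show ?thesis by simp
  qed
  moreover have "exp (1/16::real) \<le> 1 + 1/16 + (1/16)\<^sup>2" "exp (1/8::real) \<le> 1 + 1/8 + (1/8)\<^sup>2"
    by (intro exp_bound; simp)+
  then have "1/4 + exp (1/16) + 3/8 * exp (1/8) \<le> (1.7443::real)"
    by (simp add: power2_eq_square)
  ultimately have "2 powr (1/8) * (1/4 + exp (1/16) + 3/8 * exp (1/8)) \<le> (1.091 * 1.7443 :: real)"
    by (intro mult_mono) auto
  also have "\<dots> \<le> 2 * (1 + (-1/32))" by simp
  also have "\<dots> \<le> 2 * exp (-1/32)" using exp_ge_add_one_self[of "-1/32::real"] by simp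
  finally show ?thesis .
qed

section \<open>Source and target marginals\<close>

locale source_target = support_points X pts K
  for X :: "'a measure" and pts :: "nat \<Rightarrow> 'a" and K :: nat +
  fixes \<kappa> :: real
  assumes \<kappa>_pos: "0 < \<kappa>"
begin

definition source_weight :: "nat \<Rightarrow> real" where
  "source_weight j = (if j = 0 then \<kappa> / (1 + \<kappa>) else 1 / ((1 + \<kappa>) * real K))"

definition target_weight :: "nat \<Rightarrow> real" where
  "target_weight j = (if j = 0 then 0 else 1 / real K)"

definition source :: "'a measure" where "source = mixture source_weight"

definition target :: "'a measure" where "target = mixture target_weight"

lemma sum_split0: "(\<Sum>j=0..K. f j) = f 0 + (\<Sum>k=1..K. f k)" for f :: "nat \<Rightarrow> 'b::comm_monoid_add"
  by (simp add: sum.atLeast_Suc_atMost)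

lemma source_weight_nonneg: "0 \<le> source_weight j"
  using \<kappa>_pos by (simp add: source_weight_def)

lemma target_weight_nonneg: "0 \<le> target_weight j"
  by (simp add: target_weight_def)

lemma sum_source_weight: "(\<Sum>j=0..K. source_weight j) = 1"
proof -
  have "(\<Sum>k=1..K. source_weight k) = (\<Sum>k=1..K. 1 / ((1 + \<kappa>) * real K))"
    by (intro sum.cong) (auto simp: source_weight_def)
  also have "\<dots> = 1 / (1 + \<kappa>)" using K_pos by simp
  finally show ?thesis unfolding sum_split0
    using \<kappa>_pos by (simp add: source_weight_def field_simps)
qed

lemma sum_target_weight: "(\<Sum>j=0..K. target_weight j) = 1"
proof -
  have "(\<Sum>k=1..K. target_weight k) = (\<Sum>k=1..K. 1 / real K)"
    by (intro sum.cong) (auto simp: target_weight_def)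
  also have "\<dots> = 1" using K_pos by simp
  finally show ?thesis unfolding sum_split0 by (simp add: target_weight_def)
qed

lemma prob_space_source: "prob_space source"
  unfolding source_def by (rule prob_space_mixture[OF source_weight_nonneg sum_source_weight])

lemma prob_space_target: "prob_space target"
  unfolding target_def by (rule prob_space_mixture[OF target_weight_nonneg sum_target_weight])

lemma sets_source [simp, measurable_cong]: "sets source = sets X"
  by (simp add: source_def)

lemma sets_target [simp, measurable_cong]: "sets target = sets X"
  by (simp add: target_def)

lemma space_source [simp]: "space source = space X"
  by (simp add: source_def)

lemma space_target [simp]: "space target = space X"
  by (simp add: target_def)

lemma nn_integral_source:
  "(\<integral>\<^sup>+ x. f x \<partial>source) = ennreal (\<kappa> / (1 + \<kappa>)) * f (pts 0)
     + (\<Sum>k=1..K. ennreal (1 / ((1 + \<kappa>) * real K)) * f (pts k))"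
  unfolding source_def nn_integral_mixture sum_split0 by (simp add: source_weight_def)

lemma nn_integral_target:
  "(\<integral>\<^sup>+ x. f x \<partial>target) = (\<Sum>k=1..K. ennreal (1 / real K) * f (pts k))"
  unfolding target_def nn_integral_mixture sum_split0 by (simp add: target_weight_def)

lemma AE_target: "(AE x in target. P x) \<longleftrightarrow> (\<forall>k\<in>{1..K}. P (pts k))"
  unfolding target_def AE_mixture using K_pos by (auto simp: target_weight_def)

lemma emeasure_target:
  assumes "A \<in> sets X"
  shows "emeasure target A = (\<Sum>k=1..K. emeasure (return X (pts k)) A) / of_nat K"
proof -
  have "emeasure target A = (\<integral>\<^sup>+ x. indicator A x \<partial>target)" using assms by simp
  also have "\<dots> = ennreal (1 / real K) * (\<Sum>k=1..K. indicator A (pts k))"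
    by (simp add: nn_integral_target sum_distrib_left)
  also have "\<dots> = (\<Sum>k=1..K. emeasure (return X (pts k)) A) / of_nat K"
    using assms K_pos by (simp add: divide_ennreal_def mult.commute ennreal_of_nat_eq_real_of_nat
        inverse_ennreal inverse_eq_divide)
  finally show ?thesis .
qed

definition target_set :: "'a set" where "target_set = pts ` {1..K}"

lemma target_set_sets [measurable]: "target_set \<in> sets X"
  unfolding target_set_def by (rule image_pts_sets) auto

lemma pts_target_set: "j \<le> K \<Longrightarrow> pts j \<in> target_set \<longleftrightarrow> j \<noteq> 0"
  unfolding target_set_def using inj_on_image_mem_iff[OF inj_pts, of j "{1..K}"] by auto

text \<open>Each target point has source mass \<open>1 / ((1 + \<kappa>) K)\<close>, so the likelihood ratio takes only the
  values \<open>1 + \<kappa>\<close> and \<open>0\<close>; its second moment is \<open>1 + \<kappa>\<close>, which makes the divergence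
  equal to \<open>\<kappa>\<close>.\<close>

lemma density_source: "density source (\<lambda>x. ennreal ((1 + \<kappa>) * indicator target_set x)) = target"
proof (rule measure_eqI)
  fix A assume "A \<in> sets (density source (\<lambda>x. ennreal ((1 + \<kappa>) * indicator target_set x)))"
  then have A [measurable]: "A \<in> sets X" by simp
  have "emeasure (density source (\<lambda>x. ennreal ((1 + \<kappa>) * indicator target_set x))) A
     = (\<integral>\<^sup>+ x. ennreal ((1 + \<kappa>) * indicator target_set x) * indicator A x \<partial>source)"
    by (rule emeasure_density) measurable
  also have "\<dots> = (\<Sum>k=1..K. ennreal (1 / ((1 + \<kappa>) * real K)) * (ennreal (1 + \<kappa>) * indicator A (pts k)))"
    unfolding nn_integral_source by (simp add: pts_target_set indicator_def[of target_set])
  also have "\<dots> = (\<Sum>k=1..K. ennreal (1 / real K) * indicator A (pts k))"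
  proof -
    have "ennreal (1 / ((1 + \<kappa>) * real K)) * ennreal (1 + \<kappa>) = ennreal (1 / real K)"
      using \<kappa>_pos by (subst ennreal_mult[symmetric]) auto
    then show ?thesis by (simp only: mult.assoc[symmetric])
  qed
  also have "\<dots> = emeasure target A"
    using nn_integral_target[of "indicator A"] by simp
  finally show "emeasure (density source (\<lambda>x. ennreal ((1 + \<kappa>) * indicator target_set x))) A = emeasure target A" .
qed simp

lemma RN_deriv_source_target:
  "AE x in source. RN_deriv source target x = ennreal ((1 + \<kappa>) * indicator target_set x)"
proof -
  interpret S: prob_space source by (rule prob_space_source)
  have "AE x in source. ennreal ((1 + \<kappa>) * indicator target_set x) = RN_deriv source target x"
    by (rule S.RN_deriv_unique[OF _ density_source]) measurable
  then show ?thesis by eventually_elim simp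
qed

lemma absolutely_continuous_source_target: "absolutely_continuous source target"
  unfolding density_source[symmetric] by (rule absolutely_continuousI_density) measurable

lemma chi_square_source_target: "chi_square_div target source = ennreal \<kappa>"
proof -
  have "chi_square_div target source
     = (\<integral>\<^sup>+ x. ennreal (((1 + \<kappa>) * indicator target_set x - 1)\<^sup>2) \<partial>source)"
    unfolding chi_square_div_def 
  proof (rule nn_integral_cong_AE)
    show "AE x in source. ennreal ((enn2real (RN_deriv source target x) - 1)\<^sup>2)
       = ennreal (((1 + \<kappa>) * indicator target_set x - 1)\<^sup>2)"
      using RN_deriv_source_target by eventually_elim (use \<kappa>_pos in simp)
  qed
  also have "\<dots> = ennreal (\<kappa> / (1 + \<kappa>)) + (\<Sum>k=1..K. ennreal (1 / ((1 + \<kappa>) * real K)) * ennreal (\<kappa>\<^sup>2))"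
    unfolding nn_integral_source by (simp add: pts_target_set indicator_def)
  also have "\<dots> = ennreal (\<kappa> / (1 + \<kappa>) + (\<Sum>k=1..K. 1 / ((1 + \<kappa>) * real K) * \<kappa>\<^sup>2))"
  proof -
    have "(\<Sum>k=1..K. ennreal (1 / ((1 + \<kappa>) * real K)) * ennreal (\<kappa>\<^sup>2))
       = (\<Sum>k=1..K. ennreal (1 / ((1 + \<kappa>) * real K) * \<kappa>\<^sup>2))"
      using \<kappa>_pos by (intro sum.cong refl ennreal_mult[symmetric]) auto
    also have "\<dots> = ennreal (\<Sum>k=1..K. 1 / ((1 + \<kappa>) * real K) * \<kappa>\<^sup>2)"
      using \<kappa>_pos by (intro sum_ennreal) auto
    finally show ?thesis
      using \<kappa>_pos by (simp only:) (intro ennreal_plus[symmetric] sum_nonneg; simp)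
  qed
  also have "(\<Sum>k=1..K. 1 / ((1 + \<kappa>) * real K) * \<kappa>\<^sup>2) = \<kappa>\<^sup>2 / (1 + \<kappa>)"
    using K_pos by simp
  also have "\<kappa> / (1 + \<kappa>) + \<kappa>\<^sup>2 / (1 + \<kappa>) = \<kappa>"
  proof -
    have "\<kappa> + \<kappa>\<^sup>2 = \<kappa> * (1 + \<kappa>)" by (simp add: power2_eq_square algebra_simps)
    then show ?thesis using \<kappa>_pos by (simp add: add_divide_distrib[symmetric])
  qed
  finally show ?thesis .
qed

text \<open>The explicit forms of the norm for finite and infinite exponents are needed for more than
  estimation: they show that the event whose probability is bounded is measurable.\<close>

lemma Lp_norm_target_finite:
  assumes "p \<noteq> \<infinity>" "1 \<le> p"
  shows "Lp_norm p target f
    = ennreal (((\<Sum>k=1..K. \<bar>f (pts k)\<bar> powr enn2real p) / real K) powr (1 / enn2real p))"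
proof -
  have "(\<integral>\<^sup>+ x. ennreal (\<bar>f x\<bar> powr enn2real p) \<partial>target)
     = ennreal ((\<Sum>k=1..K. \<bar>f (pts k)\<bar> powr enn2real p) / real K)"
    unfolding nn_integral_target
    by (simp add: sum_divide_distrib ennreal_mult[symmetric] sum_ennreal)
  then show ?thesis using assms(1) by (simp add: Lp_norm_def Let_def sum_nonneg)
qed

lemma Lp_norm_target_infinite:
  assumes "f \<in> borel_measurable X"
  shows "c \<le> Lp_norm \<infinity> target f \<longleftrightarrow> (\<exists>k\<in>{1..K}. c \<le> ennreal \<bar>f (pts k)\<bar>)"
proof
  assume c: "c \<le> Lp_norm \<infinity> target f"
  let ?M = "Max ((\<lambda>k. ennreal \<bar>f (pts k)\<bar>) ` {1..K})"
  have ne: "{1..K} \<noteq> {}" using K_pos by auto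
  note assms [measurable]
  have "esssup target (\<lambda>x. ennreal \<bar>f x\<bar>) \<le> ?M"
    by (rule esssup_I) (measurable, simp add: AE_target)
  then have "c \<le> ?M" using c by (simp add: Lp_norm_def)
  then show "\<exists>k\<in>{1..K}. c \<le> ennreal \<bar>f (pts k)\<bar>"
    using ne by (subst (asm) Max_ge_iff) auto
next
  assume "\<exists>k\<in>{1..K}. c \<le> ennreal \<bar>f (pts k)\<bar>"
  then obtain k where k: "k \<in> {1..K}" "c \<le> ennreal \<bar>f (pts k)\<bar>" by blast
  have "AE x in target. ennreal \<bar>f x\<bar> \<le> esssup target (\<lambda>x. ennreal \<bar>f x\<bar>)" by (rule esssup_AE)
  then have "ennreal \<bar>f (pts k)\<bar> \<le> esssup target (\<lambda>x. ennreal \<bar>f x\<bar>)" using k(1) by (simp add: AE_target)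
  then show "c \<le> Lp_norm \<infinity> target f" using k(2) by (simp add: Lp_norm_def)
qed

text \<open>All exponents are treated at once because \<open>\<theta> powr (1/r) \<ge> \<theta>\<close> when \<open>r \<ge> 1\<close> and
  \<open>\<theta> \<le> 1\<close>.\<close>

lemma Lp_norm_target_lower_bound:
  assumes f: "f \<in> borel_measurable X" and p: "1 \<le> p" and d: "0 \<le> d"
    and W: "W \<subseteq> {1..K}" "\<And>k. k \<in> W \<Longrightarrow> d \<le> \<bar>f (pts k)\<bar>"
    and frac: "0 < \<theta>" "\<theta> \<le> 1" "\<theta> * real K \<le> real (card W)"
  shows "ennreal (\<theta> * d) \<le> Lp_norm p target f"
proof (cases "p = \<infinity>")
  case True
  have "0 < \<theta> * real K" using frac K_pos by simp
  then have "card W \<noteq> 0" using frac(3) by linarith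
  then obtain k where k: "k \<in> W" by fastforce
  have "\<theta> * d \<le> d" using frac d by (intro mult_left_le_one_le) auto
  also have "d \<le> \<bar>f (pts k)\<bar>" by (rule W(2)[OF k])
  finally show ?thesis
    unfolding True Lp_norm_target_infinite[OF f] using W(1) k by (auto intro!: bexI[of _ k] ennreal_leI)
next
  case False
  define r where "r = enn2real p"
  have r: "1 \<le> r" unfolding r_def using p False
    by (metis enn2real_1 enn2real_mono infinity_ennreal_def less_top)
  have "\<theta> * d powr r \<le> (\<Sum>k=1..K. \<bar>f (pts k)\<bar> powr r) / real K"
  proof -
    have "\<theta> * real K * d powr r \<le> real (card W) * d powr r"
      using frac by (intro mult_right_mono) auto
    also have "\<dots> = (\<Sum>k\<in>W. d powr r)" by simp
    also have "\<dots> \<le> (\<Sum>k\<in>W. \<bar>f (pts k)\<bar> powr r)"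
      using W d r by (intro sum_mono powr_mono2) auto
    also have "\<dots> \<le> (\<Sum>k=1..K. \<bar>f (pts k)\<bar> powr r)"
      using W by (intro sum_mono2) auto
    finally show ?thesis using K_pos by (simp add: field_simps)
  qed
  then have "(\<theta> * d powr r) powr (1 / r)
      \<le> ((\<Sum>k=1..K. \<bar>f (pts k)\<bar> powr r) / real K) powr (1 / r)"
    using frac r by (intro powr_mono2) auto
  moreover have "\<theta> * d \<le> (\<theta> * d powr r) powr (1 / r)"
  proof -
    have "(\<theta> * d powr r) powr (1 / r) = \<theta> powr (1 / r) * d"
      using frac d r by (simp add: powr_mult powr_powr)
    moreover have "\<theta> powr 1 \<le> \<theta> powr (1 / r)"
      using frac r by (intro powr_mono') auto
    ultimately show ?thesis using d frac by (simp add: mult_right_mono)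
  qed
  ultimately show ?thesis
    unfolding Lp_norm_target_finite[OF False p] r_def[symmetric] by (intro ennreal_leI) linarith
qed

end

section \<open>The family of sign-perturbed kernels\<close>

definition tilt_sign :: "bool \<Rightarrow> real" where
  "tilt_sign b = (if b then 1 else - 1)"

lemma abs_tilt_sign: "\<bar>tilt_sign b\<bar> \<le> 1"
  by (simp add: tilt_sign_def)

text \<open>The last assumption fixes the size of the perturbation by the expected number of observations
  at a target point, \<open>m / ((1 + \<kappa>) K)\<close>: multiplied by the information of one observation, it
  equals \<open>1/16\<close>, so a site reveals its sign only weakly.\<close>

locale hard_family = source_target X pts K \<kappa>
  for X :: "'a measure" and pts :: "nat \<Rightarrow> 'a" and K :: nat and \<kappa> :: real +
  fixes \<alpha> \<delta> :: real and m :: nat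
  assumes \<alpha>: "0 < \<alpha>" "\<alpha> < 1"
    and \<delta>: "0 \<le> \<delta>" "\<delta> \<le> min \<alpha> (1 - \<alpha>) / 2"
    and information: "16 * real m * \<delta>\<^sup>2 = (1 + \<kappa>) * \<alpha> * (1 - \<alpha>) * real K"
begin

text \<open>The value \<open>0\<close> off the target points selects the reference law there.\<close>

definition site_sign :: "(nat \<Rightarrow> bool) \<Rightarrow> 'a \<Rightarrow> real" where
  "site_sign \<sigma> x = (if x \<in> pts ` {1..K} then tilt_sign (\<sigma> (inv_into {1..K} pts x)) else 0)"

definition sign_kernel :: "(nat \<Rightarrow> bool) \<Rightarrow> 'a \<Rightarrow> real measure" where
  "sign_kernel \<sigma> x = tilted \<alpha> \<delta> (site_sign \<sigma> x)"

text \<open>The factor that one site contributes to the likelihood ratio of one observation. It is defined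
  for a real \<open>s\<close> and identically \<open>1\<close> off its site, which makes likelihood ratios products
  over sites as well as over observations.\<close>

definition factor :: "nat \<Rightarrow> real \<Rightarrow> 'a \<times> real \<Rightarrow> real" where
  "factor k s z = (if fst z = pts k then 1 + s * tilt_fn \<alpha> \<delta> (snd z) else 1)"

lemma inj_pts1: "inj_on pts {1..K}"
  by (rule inj_on_subset[OF inj_pts]) auto

lemma site_sign_pts: "k \<in> {1..K} \<Longrightarrow> site_sign \<sigma> (pts k) = tilt_sign (\<sigma> k)"
  using inv_into_f_f[OF inj_pts1] by (auto simp: site_sign_def)

lemma abs_site_sign: "\<bar>site_sign \<sigma> x\<bar> \<le> 1"
  by (auto simp: site_sign_def tilt_sign_def)

lemma sign_kernel_pts: "k \<in> {1..K} \<Longrightarrow> sign_kernel \<sigma> (pts k) = tilted \<alpha> \<delta> (tilt_sign (\<sigma> k))"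
  by (simp add: sign_kernel_def site_sign_pts)

lemma tilted_in_prob_algebra: "\<bar>s\<bar> \<le> 1 \<Longrightarrow> tilted \<alpha> \<delta> s \<in> space (prob_algebra borel)"
  using prob_space_tilted[OF \<alpha> \<delta>] by (simp add: space_prob_algebra)

lemma sign_kernel_measurable: "sign_kernel \<sigma> \<in> X \<rightarrow>\<^sub>M prob_algebra borel"
proof (rule measurable_off_points[of "\<lambda>_. tilted \<alpha> \<delta> 0"])
  show "(\<lambda>_. tilted \<alpha> \<delta> 0) \<in> X \<rightarrow>\<^sub>M prob_algebra borel"
    by (intro measurable_const tilted_in_prob_algebra) simp
  show "sign_kernel \<sigma> x = tilted \<alpha> \<delta> 0" if "x \<notin> pts ` {0..K}" for x
    using that by (auto simp: sign_kernel_def site_sign_def)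
  show "sign_kernel \<sigma> (pts j) \<in> space (prob_algebra borel)" for j
    unfolding sign_kernel_def by (intro tilted_in_prob_algebra abs_site_sign)
qed

lemma sign_kernel_admissible: "sign_kernel \<sigma> \<in> admissible_kernels \<alpha> source"
proof -
  interpret S: prob_space source by (rule prob_space_source)
  have "mass_regular_on \<alpha> (sign_kernel \<sigma>) (space X)"
    unfolding sign_kernel_def using \<alpha>
    by (intro uniform_like_mass_regular[of _ "1/2" "3/2"] uniform_like_tilted[OF \<alpha> \<delta>] abs_site_sign) auto
  moreover have "sign_kernel \<sigma> \<in> source \<rightarrow>\<^sub>M prob_algebra borel"
    using sign_kernel_measurable measurable_cong_sets[OF sets_source refl] by blast
  ultimately show ?thesis
    unfolding admissible_kernels_def using S.emeasure_space_1
    by (auto intro!: bexI[of _ "space X"])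
qed

lemma factor_measurable [measurable]:
  "k \<le> K \<Longrightarrow> factor k s \<in> borel_measurable (X \<Otimes>\<^sub>M borel)"
proof -
  assume k: "k \<le> K"
  have [measurable]: "Measurable.pred (X \<Otimes>\<^sub>M borel) (\<lambda>z. fst z = pts k)"
    by (rule pred_eq_const1[OF measurable_fst pts_sets[OF k]])
  show ?thesis unfolding factor_def by measurable
qed

lemma factor_pos: "\<bar>s\<bar> \<le> 1 \<Longrightarrow> 0 < factor k s z"
  using tilt_density_bounds(1)[OF \<alpha> \<delta>, of s "snd z"] by (auto simp: factor_def)

lemma factor_nonneg: "\<bar>s\<bar> \<le> 1 \<Longrightarrow> 0 \<le> factor k s z"
  using factor_pos by (rule less_imp_le)

lemma factor_powi_measurable [measurable]:
  "k \<le> K \<Longrightarrow> (\<lambda>z. factor k s z powi n) \<in> borel_measurable (X \<Otimes>\<^sub>M borel)"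
  unfolding power_int_def by (cases "0 \<le> n") simp_all

lemma site_density:
  "1 + site_sign \<sigma> x * tilt_fn \<alpha> \<delta> y = (\<Prod>k=1..K. factor k (tilt_sign (\<sigma> k)) (x, y))"
proof (cases "x \<in> pts ` {1..K}")
  case True
  then obtain k where k: "k \<in> {1..K}" "x = pts k" by auto
  have "(\<Prod>i=1..K. factor i (tilt_sign (\<sigma> i)) (x, y))
      = factor k (tilt_sign (\<sigma> k)) (x, y) * (\<Prod>i\<in>{1..K} - {k}. factor i (tilt_sign (\<sigma> i)) (x, y))"
    using k by (subst prod.remove[of _ k]) auto
  also have "(\<Prod>i\<in>{1..K} - {k}. factor i (tilt_sign (\<sigma> i)) (x, y)) = 1"
  proof (intro prod.neutral ballI)
    fix i assume "i \<in> {1..K} - {k}"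
    then have "pts k \<noteq> pts i" using inj_onD[OF inj_pts1 _ k(1), of i] by auto
    then show "factor i (tilt_sign (\<sigma> i)) (x, y) = 1" using k by (simp add: factor_def)
  qed
  finally show ?thesis using k by (simp add: site_sign_pts factor_def)
next
  case False
  then have "(\<Prod>i=1..K. factor i (tilt_sign (\<sigma> i)) (x, y)) = 1"
  proof (intro prod.neutral ballI)
    fix i assume "i \<in> {1..K}"
    then have "x \<noteq> pts i" using False by blast
    then show "factor i (tilt_sign (\<sigma> i)) (x, y) = 1" by (simp add: factor_def)
  qed
  then show ?thesis using False by (simp add: site_sign_def)
qed

definition ref_law :: "('a \<times> real) measure" where
  "ref_law = joint_law source (\<lambda>_. unif01)"

definition ref_sample :: "(nat \<Rightarrow> 'a \<times> real) measure" where
  "ref_sample = (\<Pi>\<^sub>M i\<in>{1..m}. ref_law)"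

definition site_likelihood :: "nat \<Rightarrow> bool \<Rightarrow> (nat \<Rightarrow> 'a \<times> real) \<Rightarrow> real" where
  "site_likelihood k b \<omega> = (\<Prod>i=1..m. factor k (tilt_sign b) (\<omega> i))"

lemma space_X_ne: "space X \<noteq> {}"
  using pts_space[of 0] by auto

lemma sets_ref_law [simp, measurable_cong]: "sets ref_law = sets (X \<Otimes>\<^sub>M borel)"
  unfolding ref_law_def by (rule sets_joint_law[OF sets_source unif01_kernel space_X_ne])

lemma prob_space_ref_law: "prob_space ref_law"
  unfolding ref_law_def by (rule prob_space_joint_law[OF prob_space_source sets_source unif01_kernel])

lemma sets_ref_sample: "sets ref_sample = sets (\<Pi>\<^sub>M i\<in>{1..m}. X \<Otimes>\<^sub>M borel)"
  unfolding ref_sample_def by (intro sets_PiM_cong) auto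

lemma factor_ref_measurable [measurable]: "k \<le> K \<Longrightarrow> factor k s \<in> borel_measurable ref_law"
  using factor_measurable measurable_cong_sets[OF sets_ref_law refl] by blast

lemma factor_powi_ref_measurable:
  "k \<le> K \<Longrightarrow> (\<lambda>z. factor k s z powi n) \<in> borel_measurable ref_law"
  using factor_powi_measurable measurable_cong_sets[OF sets_ref_law refl] by blast

lemma sample_law_density:
  "sample_law m source (sign_kernel \<sigma>)
    = density ref_sample (\<lambda>\<omega>. ennreal (\<Prod>k=1..K. site_likelihood k (\<sigma> k) \<omega>))"
proof -
  let ?g = "\<lambda>z. ennreal (\<Prod>k=1..K. factor k (tilt_sign (\<sigma> k)) z)"
  have g: "?g \<in> borel_measurable (X \<Otimes>\<^sub>M borel)" by measurable
  have nn: "0 \<le> (\<Prod>k=1..K. factor k (tilt_sign (\<sigma> k)) z)" for z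
    by (intro prod_nonneg ballI factor_nonneg abs_tilt_sign)
  have J: "density ref_law ?g = joint_law source (sign_kernel \<sigma>)"
    unfolding ref_law_def
  proof (rule density_joint_law[OF sets_source space_X_ne unif01_kernel sign_kernel_measurable g])
    show "sign_kernel \<sigma> x = density unif01 (\<lambda>y. ?g (x, y))" for x
      by (simp add: sign_kernel_def tilted_def site_density)
  qed
  have P: "prob_space (density ref_law ?g)"
    unfolding J by (rule prob_space_joint_law[OF prob_space_source sets_source sign_kernel_measurable])
  have "(\<Prod>i=1..m. ?g (\<omega> i)) = ennreal (\<Prod>k=1..K. site_likelihood k (\<sigma> k) \<omega>)" for \<omega>
    unfolding site_likelihood_def prod.swap[of _ "{1..m}" "{1..K}"] using nn by (intro prod_ennreal)
  then show ?thesis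
    unfolding sample_law_def J[symmetric] ref_sample_def
    using density_PiM[OF _ prob_space_ref_law P, of "{1..m}"] g by simp
qed

lemma site_moment:
  assumes "l \<in> monomials"
  shows "(\<integral>\<^sup>+ y. ennreal ((1 + snd l * tilt_fn \<alpha> \<delta> y) powi fst l) \<partial>unif01)
    \<le> ennreal (1 + monomial_cost l * (\<delta>\<^sup>2 / (\<alpha> * (1 - \<alpha>))))"
proof -
  interpret U: prob_space unif01 by (rule prob_space_unif01)
  have "emeasure unif01 UNIV = 1" using U.emeasure_space_1 by simp
  then show ?thesis
    using assms second_moment_tilt[OF \<alpha> \<delta>, of "snd l"] inverse_moment_tilt[OF \<alpha> \<delta>, of "snd l"]
    unfolding monomials_def monomial_cost_def by (elim insertE emptyE) simp_all
qed

text \<open>An observation lies on at most one site, so the product over the sites has a single factor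
  different from \<open>1\<close>, and the expectation is affine in the per-site moments.\<close>

lemma joint_moment:
  assumes "\<phi> \<in> {1..K} \<rightarrow>\<^sub>E monomials"
  shows "(\<integral>\<^sup>+ z. ennreal (\<Prod>k=1..K. factor k (snd (\<phi> k)) z powi fst (\<phi> k)) \<partial>ref_law)
    \<le> ennreal (exp (\<Sum>k=1..K. \<delta>\<^sup>2 / (\<alpha> * (1 - \<alpha>)) / ((1 + \<kappa>) * real K) * monomial_cost (\<phi> k)))"
proof -
  interpret U: prob_space unif01 by (rule prob_space_unif01)
  have U1: "emeasure unif01 UNIV = 1" using U.emeasure_space_1 by simp
  define v where "v = \<delta>\<^sup>2 / (\<alpha> * (1 - \<alpha>))"
  have v: "0 \<le> v" using \<alpha> by (simp add: v_def)
  let ?w = "1 / ((1 + \<kappa>) * real K)"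
  have w: "0 \<le> ?w" using \<kappa>_pos by simp
  have cost: "0 \<le> monomial_cost l" for l by (simp add: monomial_cost_def)
  let ?f = "\<lambda>z. \<Prod>k=1..K. factor k (snd (\<phi> k)) z powi fst (\<phi> k)"
  have f: "(\<lambda>z. ennreal (?f z)) \<in> borel_measurable (X \<Otimes>\<^sub>M borel)"
    by measurable
  have at: "?f (pts j, y) = (if j = 0 then 1 else (1 + snd (\<phi> j) * tilt_fn \<alpha> \<delta> y) powi fst (\<phi> j))"
    if "j \<le> K" for j y
  proof -
    have eq: "pts j = pts k \<longleftrightarrow> j = k" if "k \<in> {1..K}" for k
      using inj_on_eq_iff[OF inj_pts, of j k] that \<open>j \<le> K\<close> by auto
    have "?f (pts j, y) = (\<Prod>k=1..K. if j = k then (1 + snd (\<phi> j) * tilt_fn \<alpha> \<delta> y) powi fst (\<phi> j) else 1)"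
      by (intro prod.cong refl) (auto simp: factor_def eq)
    also have "\<dots> = (if j \<in> {1..K} then (1 + snd (\<phi> j) * tilt_fn \<alpha> \<delta> y) powi fst (\<phi> j) else 1)"
      by (simp add: prod.delta')
    finally show ?thesis using that by auto
  qed
  have "(\<integral>\<^sup>+ z. ennreal (?f z) \<partial>ref_law) = (\<integral>\<^sup>+ x. \<integral>\<^sup>+ y. ennreal (?f (x, y)) \<partial>unif01 \<partial>source)"
    unfolding ref_law_def by (rule nn_integral_joint_law[OF sets_source unif01_kernel f])
  also have "\<dots> = ennreal (\<kappa> / (1 + \<kappa>))
     + (\<Sum>k=1..K. ennreal ?w * (\<integral>\<^sup>+ y. ennreal ((1 + snd (\<phi> k) * tilt_fn \<alpha> \<delta> y) powi fst (\<phi> k)) \<partial>unif01))"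
  proof -
    have at0: "(\<integral>\<^sup>+ y. ennreal (?f (pts 0, y)) \<partial>unif01) = 1"
      by (simp only: at[OF le0] if_True) (simp add: U1)
    have atk: "(\<integral>\<^sup>+ y. ennreal (?f (pts k, y)) \<partial>unif01)
       = (\<integral>\<^sup>+ y. ennreal ((1 + snd (\<phi> k) * tilt_fn \<alpha> \<delta> y) powi fst (\<phi> k)) \<partial>unif01)"
      if "k \<in> {1..K}" for k
    proof -
      have "k \<le> K" "k \<noteq> 0" using that by auto
      then show ?thesis by (simp only: at if_False)
    qed
    show ?thesis
      unfolding nn_integral_source at0 mult_1_right
      by (intro arg_cong2[where f = "(+)"] sum.cong refl) (simp only: atk)
  qed
  also have "\<dots> \<le> ennreal (\<kappa> / (1 + \<kappa>)) + (\<Sum>k=1..K. ennreal (?w * (1 + monomial_cost (\<phi> k) * v)))"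
  proof (intro add_left_mono sum_mono)
    fix k assume k: "k \<in> {1..K}"
    have "ennreal ?w * (\<integral>\<^sup>+ y. ennreal ((1 + snd (\<phi> k) * tilt_fn \<alpha> \<delta> y) powi fst (\<phi> k)) \<partial>unif01)
        \<le> ennreal ?w * ennreal (1 + monomial_cost (\<phi> k) * v)"
      using assms k unfolding v_def by (intro mult_left_mono site_moment) auto
    also have "\<dots> = ennreal (?w * (1 + monomial_cost (\<phi> k) * v))"
      using w v cost by (intro ennreal_mult[symmetric]) auto
    finally show "ennreal ?w * (\<integral>\<^sup>+ y. ennreal ((1 + snd (\<phi> k) * tilt_fn \<alpha> \<delta> y) powi fst (\<phi> k)) \<partial>unif01)
        \<le> ennreal (?w * (1 + monomial_cost (\<phi> k) * v))" .
  qed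
  also have "\<dots> = ennreal (\<kappa> / (1 + \<kappa>) + (\<Sum>k=1..K. ?w * (1 + monomial_cost (\<phi> k) * v)))"
  proof -
    have "(\<Sum>k=1..K. ennreal (?w * (1 + monomial_cost (\<phi> k) * v)))
       = ennreal (\<Sum>k=1..K. ?w * (1 + monomial_cost (\<phi> k) * v))"
      using w v cost by (intro sum_ennreal mult_nonneg_nonneg) auto
    moreover have "0 \<le> (\<Sum>k=1..K. ?w * (1 + monomial_cost (\<phi> k) * v))"
      using w v cost by (intro sum_nonneg mult_nonneg_nonneg) auto
    ultimately show ?thesis using \<kappa>_pos by (simp only: ennreal_plus) simp
  qed
  also have "\<kappa> / (1 + \<kappa>) + (\<Sum>k=1..K. ?w * (1 + monomial_cost (\<phi> k) * v))
      = 1 + (\<Sum>k=1..K. v / ((1 + \<kappa>) * real K) * monomial_cost (\<phi> k))"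
  proof -
    have "(\<Sum>k=1..K. ?w * (1 + monomial_cost (\<phi> k) * v))
       = (\<Sum>k=1..K. ?w) + (\<Sum>k=1..K. v / ((1 + \<kappa>) * real K) * monomial_cost (\<phi> k))"
      unfolding sum.distrib[symmetric] by (intro sum.cong refl) (simp add: algebra_simps add_divide_distrib)
    moreover have "(\<Sum>k=1..K. ?w) = 1 / (1 + \<kappa>)" using K_pos by simp
    moreover have "\<kappa> / (1 + \<kappa>) + 1 / (1 + \<kappa>) = 1" using \<kappa>_pos by (simp add: field_simps)
    ultimately show ?thesis by linarith
  qed
  also have "ennreal \<dots> \<le> ennreal (exp (\<Sum>k=1..K. v / ((1 + \<kappa>) * real K) * monomial_cost (\<phi> k)))"
    by (intro ennreal_leI) (rule exp_ge_add_one_self)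
  finally show ?thesis unfolding v_def .
qed

lemma site_likelihood_pos: "0 < site_likelihood k b \<omega>"
  unfolding site_likelihood_def by (intro prod_pos ballI factor_pos abs_tilt_sign)

lemma site_likelihood_measurable [measurable]:
  "k \<le> K \<Longrightarrow> site_likelihood k b \<in> borel_measurable ref_sample"
  unfolding site_likelihood_def ref_sample_def by measurable

text \<open>The bound \<open>posterior_error_bound\<close> for site \<open>k\<close>, written as the combination of monomials that
  \<open>tensor_moment_bound\<close> integrates.\<close>

definition majorant :: "nat \<Rightarrow> (nat \<Rightarrow> 'a \<times> real) \<Rightarrow> real" where
  "majorant k \<omega> = (\<Sum>l\<in>monomials. monomial_coeff l * (\<Prod>i=1..m. factor k (snd l) (\<omega> i) powi fst l))"

lemma majorant_eq:
  "majorant k \<omega> = 1/4 + ((site_likelihood k True \<omega>)\<^sup>2 + (site_likelihood k False \<omega>)\<^sup>2) / 2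
    + 3/16 * (inverse (site_likelihood k True \<omega>) + inverse (site_likelihood k False \<omega>))"
proof -
  have "(\<Prod>i=1..m. factor k s (\<omega> i) powi 2) = (\<Prod>i=1..m. factor k s (\<omega> i))\<^sup>2" for s
    by (simp add: prod_power_distrib)
  moreover have "(\<Prod>i=1..m. factor k s (\<omega> i) powi (-1)) = inverse (\<Prod>i=1..m. factor k s (\<omega> i))" for s
    using prod_inversef[of "\<lambda>i. factor k s (\<omega> i)" "{1..m}"] by (simp add: power_int_minus o_def)
  ultimately show ?thesis
    unfolding majorant_def site_likelihood_def monomials_def monomial_coeff_def tilt_sign_def
    by (simp add: add_divide_distrib)
qed

lemma nn_integral_majorant:
  "(\<integral>\<^sup>+ \<omega>. ennreal (\<Prod>k=1..K. majorant k \<omega>) \<partial>ref_sample)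
    \<le> ennreal ((1/4 + exp (1/16) + 3/8 * exp (1/8)) ^ K)"
proof -
  let ?e = "\<lambda>l. \<delta>\<^sup>2 / (\<alpha> * (1 - \<alpha>)) / ((1 + \<kappa>) * real K) * monomial_cost l"
  have rate: "real (card {1..m}) * ?e l = monomial_cost l / 16" for l
  proof -
    have "real m * (\<delta>\<^sup>2 / (\<alpha> * (1 - \<alpha>)) / ((1 + \<kappa>) * real K)) = 1 / 16"
    proof -
      define A B where "A = \<alpha> * (1 - \<alpha>)" and "B = (1 + \<kappa>) * real K"
      have "0 < A" "0 < B" using \<alpha> \<kappa>_pos K_pos by (simp_all add: A_def B_def)
      moreover have "16 * (real m * \<delta>\<^sup>2) = A * B"
        using information by (simp add: A_def B_def mult_ac)
      ultimately show ?thesis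
        unfolding A_def[symmetric] B_def[symmetric] by (simp add: field_simps)
    qed
    moreover have "real (card {1..m}) * ?e l
       = real m * (\<delta>\<^sup>2 / (\<alpha> * (1 - \<alpha>)) / ((1 + \<kappa>) * real K)) * monomial_cost l"
      by (simp only: mult.assoc card_atLeastAtMost diff_Suc_1 Suc_eq_plus1[symmetric])
    ultimately show ?thesis by (simp only:)
  qed
  have "(\<integral>\<^sup>+ \<omega>. ennreal (\<Prod>k=1..K. majorant k \<omega>) \<partial>ref_sample)
    \<le> ennreal ((\<Sum>l\<in>monomials. monomial_coeff l * exp (real (card {1..m}) * ?e l)) ^ card {1..K})"
    unfolding majorant_def ref_sample_def
  proof (rule tensor_moment_bound[where h = "\<lambda>k l z. factor k (snd l) z powi fst l"])
    show "finite monomials" by (rule finite_monomials)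
    show "prob_space ref_law" by (rule prob_space_ref_law)
    show "0 \<le> monomial_coeff l" for l by (simp add: monomial_coeff_def)
    show "0 \<le> factor k (snd l) z powi fst l" if "l \<in> monomials" for k l z
      by (intro zero_le_power_int factor_nonneg) (use that in \<open>auto simp: monomials_def\<close>)
    show "(\<lambda>z. factor k (snd l) z powi fst l) \<in> borel_measurable ref_law" if "k \<in> {1..K}" for k l
      using that by (intro factor_powi_ref_measurable) simp
  qed (use joint_moment in auto)
  also have "(\<Sum>l\<in>monomials. monomial_coeff l * exp (real (card {1..m}) * ?e l))
     = 1/4 + exp (1/16) + 3/8 * exp (1/8)"
    unfolding rate by (simp add: monomials_def monomial_coeff_def monomial_cost_def)
  finally show ?thesis by simp
qed

text \<open>A decision \<open>d k\<close> records that the threshold at site \<open>k\<close> is nonnegative. A nonnegative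
  threshold is harmful when the band has too much mass, a negative one when it has too little,
  so a decision that agrees with the sign is the wrong one.\<close>

definition wrong :: "(nat \<Rightarrow> bool) \<Rightarrow> (nat \<Rightarrow> bool) \<Rightarrow> nat set" where
  "wrong \<sigma> d = {k \<in> {1..K}. \<sigma> k = d k}"

text \<open>A factor \<open>1/4\<close> for each of fewer than \<open>K/16\<close> wrong decisions multiplies to more than
  \<open>2 powr (- K/8)\<close>, so \<open>2 powr (K/8)\<close> times these factors dominates the indicator. After this the sum over
  all sign patterns factorises over the sites, whatever the decisions are.\<close>

lemma averaged_likelihood_bound:
  "(\<Sum>\<sigma>\<in>{1..K} \<rightarrow>\<^sub>E UNIV. (\<Prod>k=1..K. site_likelihood k (\<sigma> k) \<omega>)
      * indicator {d. 16 * card (wrong \<sigma> d) < K} d)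
    \<le> 2 powr (real K / 8) * (\<Prod>k=1..K. majorant k \<omega>)"
proof -
  let ?z = "\<lambda>\<sigma> k. if \<sigma> k = d k then 1/4 else 1 :: real"
  have ind: "indicator {d. 16 * card (wrong \<sigma> d) < K} d \<le> 2 powr (real K / 8) * (\<Prod>k=1..K. ?z \<sigma> k)" for \<sigma>
  proof -
    have "(\<Prod>k=1..K. ?z \<sigma> k) = (\<Prod>k\<in>wrong \<sigma> d. 1/4)"
      unfolding wrong_def by (rule prod.inter_filter[symmetric]) simp
    also have "\<dots> = 2 powr (- 2 * real (card (wrong \<sigma> d)))"
    proof -
      have "2 powr (- 2 * real n) = (1/4 :: real) ^ n" for n
        by (simp add: powr_powr[symmetric] powr_realpow powr_minus powr_numeral power_one_over inverse_eq_divide del: powr_powr)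
      then show ?thesis by simp
    qed
    finally have "2 powr (real K / 8) * (\<Prod>k=1..K. ?z \<sigma> k) = 2 powr (real K / 8 - 2 * real (card (wrong \<sigma> d)))"
      by (simp add: powr_add[symmetric])
    moreover have "1 \<le> 2 powr (real K / 8 - 2 * real (card (wrong \<sigma> d)))" if "16 * card (wrong \<sigma> d) < K"
      using that by (intro ge_one_powr_ge_zero) auto
    ultimately show ?thesis by (auto simp: indicator_def)
  qed
  have "(\<Sum>\<sigma>\<in>{1..K} \<rightarrow>\<^sub>E UNIV. (\<Prod>k=1..K. site_likelihood k (\<sigma> k) \<omega>)
      * indicator {d. 16 * card (wrong \<sigma> d) < K} d)
     \<le> (\<Sum>\<sigma>\<in>{1..K} \<rightarrow>\<^sub>E UNIV. (\<Prod>k=1..K. site_likelihood k (\<sigma> k) \<omega>)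
      * (2 powr (real K / 8) * (\<Prod>k=1..K. ?z \<sigma> k)))"
    by (intro sum_mono mult_left_mono ind prod_nonneg) (auto intro: less_imp_le site_likelihood_pos)
  also have "\<dots> = 2 powr (real K / 8) *
      (\<Sum>\<sigma>\<in>{1..K} \<rightarrow>\<^sub>E UNIV. \<Prod>k=1..K. site_likelihood k (\<sigma> k) \<omega> * ?z \<sigma> k)"
    by (simp add: sum_distrib_left prod.distrib mult_ac)
  also have "(\<Sum>\<sigma>\<in>{1..K} \<rightarrow>\<^sub>E UNIV. \<Prod>k=1..K. site_likelihood k (\<sigma> k) \<omega> * ?z \<sigma> k)
      = (\<Prod>k=1..K. \<Sum>b\<in>UNIV. site_likelihood k b \<omega> * (if b = d k then 1/4 else 1))"
    by (rule prod_sum_PiE[symmetric]) auto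
  also have "\<dots> \<le> (\<Prod>k=1..K. majorant k \<omega>)"
  proof (intro prod_mono conjI)
    fix k
    let ?L = "\<lambda>b. site_likelihood k b \<omega>"
    show "0 \<le> (\<Sum>b\<in>UNIV. ?L b * (if b = d k then 1/4 else 1))"
      by (intro sum_nonneg mult_nonneg_nonneg) (auto intro: less_imp_le site_likelihood_pos)
    show "(\<Sum>b\<in>UNIV. ?L b * (if b = d k then 1/4 else 1)) \<le> majorant k \<omega>"
      using posterior_error_bound[of "?L True" "?L False"] posterior_error_bound[of "?L False" "?L True"]
      by (cases "d k") (simp_all add: UNIV_bool majorant_eq site_likelihood_pos add_ac)
  qed
  finally show ?thesis by (simp add: mult_left_mono)
qed

end

section \<open>Coverage errors and the minimax bound\<close>

lemma cond_quantile_unif01: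
  assumes "0 < \<tau>" "\<tau> < 1"
  shows "cond_quantile (\<lambda>_. unif01) \<tau> x = \<tau>"
proof -
  have "uniform_like 1 1 unif01"
    by (simp add: uniform_like_def prob_space_unif01)
  from uniform_like_quantile(1,2)[where P = "\<lambda>_. unif01", OF this assms, of x] show ?thesis by simp
qed

lemma cqr_score_unif01:
  assumes "0 < \<alpha>" "\<alpha> < 1"
  shows "cqr_score \<alpha> (\<lambda>_. unif01) x y = max (\<alpha>/2 - y) (y - (1 - \<alpha>/2))"
  using assms by (simp add: cqr_score_def cond_quantile_unif01)

context hard_family
begin

abbreviation score :: "'a \<Rightarrow> real \<Rightarrow> real" where
  "score \<equiv> cqr_score \<alpha> (\<lambda>_. unif01)"

definition level_set :: "ereal \<Rightarrow> real set" where
  "level_set t = {y. ereal (max (\<alpha>/2 - y) (y - (1 - \<alpha>/2))) \<le> t}"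

lemma level_set_borel [measurable]: "level_set t \<in> sets borel"
  unfolding level_set_def by measurable

lemma level_set_mono: "s \<le> t \<Longrightarrow> level_set s \<subseteq> level_set t"
  by (auto simp: level_set_def intro: order_trans)

lemma level_set_0: "level_set 0 = band \<alpha>"
  by (auto simp: level_set_def band_def zero_ereal_def)

lemma coverage_eq: "coverage (sign_kernel \<sigma>) score q x = measure (sign_kernel \<sigma> x) (level_set (q x))"
  by (simp add: coverage_def level_set_def cqr_score_unif01[OF \<alpha>])

lemma coverage_pts:
  assumes "k \<in> {1..K}"
  shows "coverage (sign_kernel \<sigma>) score (canonical_ext K pts q) (pts k)
    = measure (tilted \<alpha> \<delta> (tilt_sign (\<sigma> k))) (level_set (q k))"
  using assms inv_into_f_f[OF inj_pts1 assms]
  by (simp add: coverage_eq sign_kernel_pts canonical_ext_def)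

text \<open>Level sets of the score are nested, so a nonnegative threshold covers at least the band and a
  negative one at most the band.\<close>

lemma coverage_error_wrong:
  assumes "k \<in> wrong \<sigma> (\<lambda>k. 0 \<le> q k)"
  shows "\<delta> \<le> \<bar>coverage (sign_kernel \<sigma>) score (canonical_ext K pts q) (pts k) - (1 - \<alpha>)\<bar>"
proof -
  have k: "k \<in> {1..K}" and s: "\<sigma> k \<longleftrightarrow> 0 \<le> q k" using assms by (auto simp: wrong_def)
  interpret N: prob_space "tilted \<alpha> \<delta> (tilt_sign (\<sigma> k))"
    by (rule prob_space_tilted[OF \<alpha> \<delta> abs_tilt_sign])
  have band: "N.prob (level_set 0) = 1 - \<alpha> + tilt_sign (\<sigma> k) * \<delta>"
    unfolding level_set_0 by (rule measure_tilted_band[OF \<alpha> \<delta> abs_tilt_sign])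
  show ?thesis
  proof (cases "0 \<le> q k")
    case True
    have "N.prob (level_set 0) \<le> N.prob (level_set (q k))"
      using level_set_mono[OF True] by (intro N.finite_measure_mono) simp_all
    then show ?thesis using band True s k by (simp add: coverage_pts tilt_sign_def)
  next
    case False
    then have "q k \<le> 0" by simp
    then have "N.prob (level_set (q k)) \<le> N.prob (level_set 0)"
      using level_set_mono by (intro N.finite_measure_mono) simp_all
    then show ?thesis using band False s k by (simp add: coverage_pts tilt_sign_def)
  qed
qed

lemma coverage_error_measurable:
  "(\<lambda>x. coverage (sign_kernel \<sigma>) score (canonical_ext K pts q) x - (1 - \<alpha>)) \<in> borel_measurable X"
proof (rule measurable_off_points)
  show "(\<lambda>_. measure (tilted \<alpha> \<delta> 0) (level_set 0) - (1 - \<alpha>)) \<in> borel_measurable X" by simp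
  fix x assume "x \<notin> pts ` {0..K}"
  then have "x \<notin> pts ` {1..K}" by auto
  then show "coverage (sign_kernel \<sigma>) score (canonical_ext K pts q) x - (1 - \<alpha>)
      = measure (tilted \<alpha> \<delta> 0) (level_set 0) - (1 - \<alpha>)"
    by (simp add: coverage_eq canonical_ext_def sign_kernel_def site_sign_def)
qed simp

lemma measure_level_set_measurable:
  assumes "\<bar>s\<bar> \<le> 1"
  shows "(\<lambda>t. measure (tilted \<alpha> \<delta> s) (level_set t)) \<in> borel_measurable borel"
proof -
  interpret N: prob_space "tilted \<alpha> \<delta> s" by (rule prob_space_tilted[OF \<alpha> \<delta> assms])
  \<comment> \<open>the level sets are the sections of one measurable subset of the product space\<close>
  define Q where "Q = {z \<in> space (borel \<Otimes>\<^sub>M tilted \<alpha> \<delta> s).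
     ereal (max (\<alpha>/2 - snd z) (snd z - (1 - \<alpha>/2))) \<le> fst z}"
  have "Q \<in> sets (borel \<Otimes>\<^sub>M tilted \<alpha> \<delta> s)" unfolding Q_def by measurable
  then have "(\<lambda>t. emeasure (tilted \<alpha> \<delta> s) (Pair t -` Q)) \<in> borel_measurable borel"
    by (rule N.measurable_emeasure_Pair)
  moreover have "Pair t -` Q = level_set t" for t
    by (auto simp: Q_def level_set_def space_pair_measure)
  ultimately show ?thesis unfolding measure_def by simp
qed

lemma rule_component_measurable:
  assumes "q \<in> threshold_rules m K X" "k \<in> {1..K}"
  shows "(\<lambda>\<omega>. q \<omega> k) \<in> borel_measurable ref_sample"
proof -
  have "q \<in> ref_sample \<rightarrow>\<^sub>M (\<Pi>\<^sub>M k\<in>{1..K}. borel)"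
    using assms(1) measurable_cong_sets[OF sets_ref_sample refl] unfolding threshold_rules_def by blast
  then show ?thesis
    using measurable_compose[OF _ measurable_component_singleton[OF assms(2)]] by blast
qed

text \<open>By convention \<open>emeasure\<close> vanishes on non-measurable sets, so a lower bound on the
  probability of the error event has to include its measurability.\<close>

lemma error_event_measurable:
  assumes q: "q \<in> threshold_rules m K X" and p: "1 \<le> p"
  shows "{\<omega> \<in> space ref_sample.
      c \<le> Lp_norm p target (\<lambda>x. coverage (sign_kernel \<sigma>) score (canonical_ext K pts (q \<omega>)) x - (1 - \<alpha>))}
    \<in> sets ref_sample"
proof -
  let ?f = "\<lambda>\<omega> x. coverage (sign_kernel \<sigma>) score (canonical_ext K pts (q \<omega>)) x - (1 - \<alpha>)"
  have f [measurable]: "(\<lambda>\<omega>. ?f \<omega> (pts k)) \<in> borel_measurable ref_sample" if "k \<in> {1..K}" for k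
    using measurable_compose[OF rule_component_measurable[OF q that] measure_level_set_measurable[OF abs_tilt_sign]]
    by (simp add: coverage_pts[OF that])
  show ?thesis
  proof (cases "p = \<infinity>")
    case True
    show ?thesis
      unfolding True Lp_norm_target_infinite[OF coverage_error_measurable] by measurable
  next
    case False
    show ?thesis
      unfolding Lp_norm_target_finite[OF False p] by measurable
  qed
qed

lemma wrong_event_measurable:
  assumes [measurable]: "\<And>k. k \<in> {1..K} \<Longrightarrow> Measurable.pred ref_sample (\<lambda>\<omega>. d \<omega> k)"
  shows "{\<omega> \<in> space ref_sample. 16 * card (wrong \<sigma> (d \<omega>)) < K} \<in> sets ref_sample"
proof -
  have count: "(\<Sum>k=1..K. if \<sigma> k = e k then 1 else 0) = real (card (wrong \<sigma> e))" for e
    unfolding wrong_def by (simp add: sum.If_cases Int_def)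
  have "16 * card (wrong \<sigma> e) < K \<longleftrightarrow> 16 * (\<Sum>k=1..K. if \<sigma> k = e k then 1 else 0) < real K" for e
    unfolding count by linarith
  then show ?thesis by (simp only:) measurable
qed

text \<open>The average over all sign patterns of the probabilities of few wrong decisions is an integral
  against the common reference sample, where the averaged bound applies; some pattern does at
  least as well as the average.\<close>

lemma few_wrong_rare:
  assumes d: "\<And>k. k \<in> {1..K} \<Longrightarrow> Measurable.pred ref_sample (\<lambda>\<omega>. d \<omega> k)"
  shows "\<exists>\<sigma>. emeasure (sample_law m source (sign_kernel \<sigma>))
      {\<omega> \<in> space ref_sample. 16 * card (wrong \<sigma> (d \<omega>)) < K} \<le> ennreal (exp (- real K / 32))"
proof -
  let ?\<Sigma> = "{1..K} \<rightarrow>\<^sub>E (UNIV :: bool set)"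
  let ?F = "\<lambda>\<sigma>. {\<omega> \<in> space ref_sample. 16 * card (wrong \<sigma> (d \<omega>)) < K}"
  let ?I = "\<lambda>\<sigma> \<omega>. indicator {e. 16 * card (wrong \<sigma> e) < K} (d \<omega>) :: real"
  let ?L = "\<lambda>\<sigma> \<omega>. \<Prod>k=1..K. site_likelihood k (\<sigma> k) \<omega>"
  let ?e = "\<lambda>\<sigma>. emeasure (sample_law m source (sign_kernel \<sigma>)) (?F \<sigma>)"
  have fin: "finite ?\<Sigma>" by (intro finite_PiE) auto
  have F [measurable]: "?F \<sigma> \<in> sets ref_sample" for \<sigma> by (rule wrong_event_measurable[OF d])
  have L [measurable]: "?L \<sigma> \<in> borel_measurable ref_sample" for \<sigma> by measurable
  have L0: "0 \<le> ?L \<sigma> \<omega>" for \<sigma> \<omega> by (intro prod_nonneg ballI less_imp_le[OF site_likelihood_pos])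
  have e: "?e \<sigma> = (\<integral>\<^sup>+ \<omega>. ennreal (?L \<sigma> \<omega> * ?I \<sigma> \<omega>) \<partial>ref_sample)" for \<sigma>
  proof -
    have "?e \<sigma> = (\<integral>\<^sup>+ \<omega>. ennreal (?L \<sigma> \<omega>) * indicator (?F \<sigma>) \<omega> \<partial>ref_sample)"
      unfolding sample_law_density by (rule emeasure_density) measurable
    also have "\<dots> = (\<integral>\<^sup>+ \<omega>. ennreal (?L \<sigma> \<omega> * ?I \<sigma> \<omega>) \<partial>ref_sample)"
      by (intro nn_integral_cong) (auto simp: indicator_def)
    finally show ?thesis .
  qed
  have "(\<Sum>\<sigma>\<in>?\<Sigma>. ?e \<sigma>) = (\<integral>\<^sup>+ \<omega>. (\<Sum>\<sigma>\<in>?\<Sigma>. ennreal (?L \<sigma> \<omega> * ?I \<sigma> \<omega>)) \<partial>ref_sample)"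
    unfolding e
  proof (rule nn_integral_sum[symmetric])
    fix \<sigma>
    have "(\<lambda>\<omega>. ?L \<sigma> \<omega> * indicator (?F \<sigma>) \<omega>) \<in> borel_measurable ref_sample" by measurable
    then have "(\<lambda>\<omega>. ?L \<sigma> \<omega> * ?I \<sigma> \<omega>) \<in> borel_measurable ref_sample"
      by (rule measurable_cong[THEN iffD1, rotated]) (auto simp: indicator_def)
    then show "(\<lambda>\<omega>. ennreal (?L \<sigma> \<omega> * ?I \<sigma> \<omega>)) \<in> borel_measurable ref_sample" by simp
  qed
  also have "\<dots> \<le> (\<integral>\<^sup>+ \<omega>. ennreal (2 powr (real K / 8)) * ennreal (\<Prod>k=1..K. majorant k \<omega>) \<partial>ref_sample)"
  proof (rule nn_integral_mono)
    fix \<omega>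
    have "(\<Sum>\<sigma>\<in>?\<Sigma>. ennreal (?L \<sigma> \<omega> * ?I \<sigma> \<omega>)) = ennreal (\<Sum>\<sigma>\<in>?\<Sigma>. ?L \<sigma> \<omega> * ?I \<sigma> \<omega>)"
      by (intro sum_ennreal mult_nonneg_nonneg L0) auto
    also have "\<dots> \<le> ennreal (2 powr (real K / 8) * (\<Prod>k=1..K. majorant k \<omega>))"
      by (intro ennreal_leI averaged_likelihood_bound)
    finally show "(\<Sum>\<sigma>\<in>?\<Sigma>. ennreal (?L \<sigma> \<omega> * ?I \<sigma> \<omega>))
        \<le> ennreal (2 powr (real K / 8)) * ennreal (\<Prod>k=1..K. majorant k \<omega>)"
      by (simp add: ennreal_mult')
  qed
  also have "\<dots> = ennreal (2 powr (real K / 8)) * (\<integral>\<^sup>+ \<omega>. ennreal (\<Prod>k=1..K. majorant k \<omega>) \<partial>ref_sample)"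
    by (intro nn_integral_cmult) (simp add: majorant_eq)
  also have "\<dots> \<le> ennreal (2 powr (real K / 8)) * ennreal ((1/4 + exp (1/16) + 3/8 * exp (1/8)) ^ K)"
    by (intro mult_left_mono nn_integral_majorant) simp
  also have "\<dots> = ennreal ((2 powr (1/8) * (1/4 + exp (1/16) + 3/8 * exp (1/8))) ^ K)"
    by (simp add: ennreal_mult'[symmetric] power_mult_distrib powr_power)
  also have "\<dots> \<le> ennreal ((2 * exp (- 1/32)) ^ K)"
    by (intro ennreal_leI power_mono numeric_rate) (simp add: add_nonneg_nonneg)
  also have "(2 * exp (- 1/32)) ^ K = 2 ^ K * exp (- real K / 32)"
    by (simp add: power_mult_distrib exp_of_nat_mult[symmetric])
  finally have total: "(\<Sum>\<sigma>\<in>?\<Sigma>. ?e \<sigma>) \<le> of_nat (card ?\<Sigma>) * ennreal (exp (- real K / 32))"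
    by (simp add: card_PiE ennreal_mult ennreal_power[symmetric])
  show ?thesis
  proof (rule ccontr)
    assume "\<not> ?thesis"
    then have gt: "ennreal (exp (- real K / 32)) < ?e \<sigma>" for \<sigma> by (simp add: not_le)
    define M where "M = Min (?e ` ?\<Sigma>)"
    have ne: "?\<Sigma> \<noteq> {}" by (simp add: PiE_eq_empty_iff)
    have "M \<in> ?e ` ?\<Sigma>" unfolding M_def using fin ne by (intro Min_in) auto
    then have M: "ennreal (exp (- real K / 32)) < M" using gt by auto
    have "of_nat (card ?\<Sigma>) * M \<le> (\<Sum>\<sigma>\<in>?\<Sigma>. ?e \<sigma>)"
      by (rule sum_bounded_below) (use fin in \<open>simp add: M_def\<close>)
    then have "of_nat (card ?\<Sigma>) * M \<le> of_nat (card ?\<Sigma>) * ennreal (exp (- real K / 32))"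
      using total by (rule order_trans)
    then have "M \<le> ennreal (exp (- real K / 32))"
      by (subst (asm) ennreal_mult_le_mult_iff) (auto simp: card_PiE simp del: of_nat_power)
    then show False using M by simp
  qed
qed

lemma minimax_bound:
  assumes q: "q \<in> threshold_rules m K X" and p: "1 \<le> p"
  shows "ennreal (1 - exp (- real K / 32)) \<le> (SUP P\<in>admissible_kernels \<alpha> source.
    emeasure (sample_law m source P) {\<omega> \<in> space (sample_law m source P).
      ennreal (\<delta> / 16) \<le> Lp_norm p target (\<lambda>x. coverage P score (canonical_ext K pts (q \<omega>)) x - (1 - \<alpha>))})"
proof -
  define d where "d \<omega> k = (0 \<le> q \<omega> k)" for \<omega> k
  have "Measurable.pred ref_sample (\<lambda>\<omega>. d \<omega> k)" if "k \<in> {1..K}" for k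
    using rule_component_measurable[OF q that] unfolding d_def by measurable
  note d = this
  from few_wrong_rare[where d = d, OF d] obtain \<sigma> where \<sigma>:
    "emeasure (sample_law m source (sign_kernel \<sigma>)) {\<omega> \<in> space ref_sample. 16 * card (wrong \<sigma> (d \<omega>)) < K}
      \<le> ennreal (exp (- real K / 32))" (is "emeasure ?P ?F \<le> _") by blast
  have sets: "sets ?P = sets ref_sample" by (simp add: sample_law_density)
  have space: "space ?P = space ref_sample" using sets_eq_imp_space_eq[OF sets] .
  interpret J: prob_space "joint_law source (sign_kernel \<sigma>)"
    by (rule prob_space_joint_law[OF prob_space_source sets_source sign_kernel_measurable])
  interpret P: prob_space ?P
    unfolding sample_law_def by (intro prob_space_PiM J.prob_space_axioms)
  let ?E = "{\<omega> \<in> space ?P. ennreal (\<delta> / 16)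
    \<le> Lp_norm p target (\<lambda>x. coverage (sign_kernel \<sigma>) score (canonical_ext K pts (q \<omega>)) x - (1 - \<alpha>))}"
  have E: "?E \<in> sets ?P"
    unfolding space sets by (rule error_event_measurable[OF q p])
  have sub: "space ?P \<subseteq> ?F \<union> ?E"
  proof
    fix \<omega> assume \<omega>: "\<omega> \<in> space ?P"
    show "\<omega> \<in> ?F \<union> ?E"
    proof (cases "\<omega> \<in> ?F")
      case False
      then have card: "K \<le> 16 * card (wrong \<sigma> (d \<omega>))" using \<omega> space by auto
      have "ennreal (1/16 * \<delta>) \<le> Lp_norm p target
          (\<lambda>x. coverage (sign_kernel \<sigma>) score (canonical_ext K pts (q \<omega>)) x - (1 - \<alpha>))"
      proof (rule Lp_norm_target_lower_bound[OF coverage_error_measurable p \<delta>(1)])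
        show "wrong \<sigma> (d \<omega>) \<subseteq> {1..K}" by (auto simp: wrong_def)
        show "\<delta> \<le> \<bar>coverage (sign_kernel \<sigma>) score (canonical_ext K pts (q \<omega>)) (pts k) - (1 - \<alpha>)\<bar>"
          if "k \<in> wrong \<sigma> (d \<omega>)" for k
          using that unfolding d_def by (rule coverage_error_wrong)
        show "1/16 * real K \<le> real (card (wrong \<sigma> (d \<omega>)))" using card by linarith
      qed simp_all
      then show ?thesis using \<omega> by simp
    qed simp
  qed
  have "1 \<le> emeasure ?P ?F + emeasure ?P ?E"
  proof -
    have F: "?F \<in> sets ?P" unfolding sets by (rule wrong_event_measurable[where d = d, OF d])
    have "1 = emeasure ?P (space ?P)" by (simp add: P.emeasure_space_1)
    also have "\<dots> \<le> emeasure ?P (?F \<union> ?E)" using sub E F by (intro emeasure_mono) auto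
    also have "\<dots> \<le> emeasure ?P ?F + emeasure ?P ?E" by (rule emeasure_subadditive[OF F E])
    finally show ?thesis .
  qed
  also have "\<dots> \<le> ennreal (exp (- real K / 32)) + emeasure ?P ?E"
    by (intro add_right_mono \<sigma>)
  also have "\<dots> = ennreal (exp (- real K / 32) + P.prob ?E)"
    unfolding P.emeasure_eq_measure by (rule ennreal_plus[symmetric]) simp_all
  finally have "ennreal 1 \<le> ennreal (exp (- real K / 32) + P.prob ?E)" by (simp only: ennreal_1)
  then have "1 \<le> exp (- real K / 32) + P.prob ?E"
    by (subst (asm) ennreal_le_iff) (auto intro: add_nonneg_nonneg)
  then have "ennreal (1 - exp (- real K / 32)) \<le> emeasure ?P ?E"
    unfolding P.emeasure_eq_measure by (intro ennreal_leI) linarith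
  then show ?thesis by (rule SUP_upper2[OF sign_kernel_admissible])
qed

end

section \<open>The lower bound for threshold-vector rules\<close>

lemma small_tilt:
  fixes \<alpha> \<kappa> :: real
  assumes "0 < \<alpha>" "\<alpha> < 1" "0 < \<kappa>"
    and m: "real m > (1 + \<kappa>) * \<alpha> * (1 - \<alpha>) * real K / (4 * (min \<alpha> (1 - \<alpha>))\<^sup>2)"
    and \<delta>: "\<delta> = sqrt ((1 + \<kappa>) * \<alpha> * (1 - \<alpha>) * real K / real m) / 4"
  shows "0 \<le> \<delta>" "\<delta> \<le> min \<alpha> (1 - \<alpha>) / 2"
    "16 * real m * \<delta>\<^sup>2 = (1 + \<kappa>) * \<alpha> * (1 - \<alpha>) * real K"
proof -
  define c M where "c = (1 + \<kappa>) * \<alpha> * (1 - \<alpha>) * real K" and "M = min \<alpha> (1 - \<alpha>)"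
  have c: "0 \<le> c" and M: "0 < M" using assms by (simp_all add: c_def M_def)
  have m': "c / (4 * M\<^sup>2) < real m" using m by (simp add: c_def M_def)
  moreover have "0 \<le> c / (4 * M\<^sup>2)" using c by simp
  ultimately have m0: "0 < real m" by linarith
  have \<delta>': "\<delta> = sqrt (c / real m) / 4" using \<delta> by (simp add: c_def)
  show "0 \<le> \<delta>" unfolding \<delta>' using c m0 by simp
  show "16 * real m * \<delta>\<^sup>2 = (1 + \<kappa>) * \<alpha> * (1 - \<alpha>) * real K"
    unfolding \<delta>' c_def[symmetric] using c m0 by (simp add: power_divide)
  have "c / real m \<le> (2 * M)\<^sup>2"
    using m' M m0 by (simp add: field_simps power2_eq_square)
  then have "sqrt (c / real m) \<le> 2 * M" using M by (intro real_le_lsqrt) simp_all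
  then show "\<delta> \<le> min \<alpha> (1 - \<alpha>) / 2" unfolding \<delta>' M_def[symmetric] by simp
qed

theorem theorem8:
  fixes X :: "'a measure" and \<alpha> \<kappa> :: real and K :: nat
  assumes "0 < \<alpha>" and "\<alpha> < 1" and "K \<ge> 23" and "\<kappa> > 0"
    and "\<exists>A. A \<subseteq> space X \<and> finite A \<and> card A \<ge> 2 * K \<and> (\<forall>a\<in>A. {a} \<in> sets X)"
  shows "\<exists>(PX :: 'a measure) (QX :: 'a measure) (pts :: nat \<Rightarrow> 'a)
           (P0 :: 'a \<Rightarrow> real measure) (S :: 'a \<Rightarrow> real \<Rightarrow> real).
      prob_space PX \<and> sets PX = sets X \<and>
      prob_space QX \<and> sets QX = sets X \<and>
      inj_on pts {1..K} \<and> (\<forall>k\<in>{1..K}. pts k \<in> space X \<and> {pts k} \<in> sets X) \<and>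
      P0 \<in> X \<rightarrow>\<^sub>M prob_algebra borel \<and>
      absolutely_continuous PX QX \<and>
      (\<exists>C::real. AE x in PX. RN_deriv PX QX x \<le> ennreal C) \<and>
      chi_square_div QX PX = ennreal \<kappa> \<and>
      (\<forall>A\<in>sets X. emeasure QX A = (\<Sum>k=1..K. emeasure (return X (pts k)) A) / of_nat K) \<and>
      (\<exists>X0\<in>sets X. emeasure PX X0 = 1 \<and> mass_regular_on \<alpha> P0 X0) \<and>
      (\<forall>x\<in>space X. \<forall>y. S x y = cqr_score \<alpha> P0 x y) \<and>
      (\<forall>(m::nat) (p::ennreal).
         real m > (1 + \<kappa>) * \<alpha> * (1 - \<alpha>) * real K / (4 * (min \<alpha> (1 - \<alpha>))\<^sup>2) \<longrightarrow> 1 \<le> p \<longrightarrow>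
         (INF q\<in>threshold_rules m K X. SUP P\<in>admissible_kernels \<alpha> PX.
            emeasure (sample_law m PX P)
              {\<omega>\<in>space (sample_law m PX P).
                 Lp_norm p QX (\<lambda>x. coverage P S (canonical_ext K pts (q \<omega>)) x - (1 - \<alpha>))
                   \<ge> ennreal (1/64 * sqrt ((1 + \<kappa>) * \<alpha> * (1 - \<alpha>) * real K / real m))})
         \<ge> ennreal (1 - 2 * exp (- real K / 32)))"
proof -
  obtain A where A: "A \<subseteq> space X" "finite A" "2 * K \<le> card A" "\<And>a. a \<in> A \<Longrightarrow> {a} \<in> sets X"
    using assms(5) by blast
  \<comment> \<open>\<open>K\<close> target points and one reservoir point\<close>
  obtain B where B: "B \<subseteq> A" "card B = K + 1" "finite B"
    using obtain_subset_with_card_n[of "K + 1" A] A(3) \<open>K \<ge> 23\<close> by auto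
  obtain pts where "bij_betw pts {0..<card B} B"
    using ex_bij_betw_nat_finite[OF B(3)] by blast
  then have bij: "bij_betw pts {0..K} B"
    by (simp add: B(2) atLeastLessThanSuc_atLeastAtMost)
  have ptsB: "pts j \<in> B" if "j \<le> K" for j using bij that by (auto simp: bij_betw_def)
  interpret source_target X pts K \<kappa>
  proof
    show "inj_on pts {0..K}" using bij by (rule bij_betw_imp_inj_on)
  qed (use ptsB A B \<open>K \<ge> 23\<close> \<open>\<kappa> > 0\<close> in auto)
  interpret S: prob_space source by (rule prob_space_source)
  let ?S = "cqr_score \<alpha> (\<lambda>_ :: 'a. unif01)"
  have bound: "(INF q\<in>threshold_rules m K X. SUP P\<in>admissible_kernels \<alpha> source.
            emeasure (sample_law m source P)
              {\<omega>\<in>space (sample_law m source P).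
                 Lp_norm p target (\<lambda>x. coverage P ?S (canonical_ext K pts (q \<omega>)) x - (1 - \<alpha>))
                   \<ge> ennreal (1/64 * sqrt ((1 + \<kappa>) * \<alpha> * (1 - \<alpha>) * real K / real m))})
         \<ge> ennreal (1 - 2 * exp (- real K / 32))"
    if m: "real m > (1 + \<kappa>) * \<alpha> * (1 - \<alpha>) * real K / (4 * (min \<alpha> (1 - \<alpha>))\<^sup>2)" and p: "1 \<le> p" for m p
  proof (rule INF_greatest)
    fix q assume q: "q \<in> threshold_rules m K X"
    \<comment> \<open>the perturbation scales with the sample size, while the two marginals do not depend on it\<close>
    define \<delta> where "\<delta> = sqrt ((1 + \<kappa>) * \<alpha> * (1 - \<alpha>) * real K / real m) / 4"
    interpret hard_family X pts K \<kappa> \<alpha> \<delta> m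
      by standard (use assms(1,2) small_tilt[OF assms(1,2,4) m \<delta>_def] in simp_all)
    have rate: "1/64 * sqrt ((1 + \<kappa>) * \<alpha> * (1 - \<alpha>) * real K / real m) = \<delta> / 16"
      by (simp add: \<delta>_def)
    have "ennreal (1 - 2 * exp (- real K / 32)) \<le> ennreal (1 - exp (- real K / 32))"
      by (intro ennreal_leI) simp
    also note minimax_bound[OF q p]
    finally show "ennreal (1 - 2 * exp (- real K / 32)) \<le> (SUP P\<in>admissible_kernels \<alpha> source.
            emeasure (sample_law m source P)
              {\<omega>\<in>space (sample_law m source P).
                 Lp_norm p target (\<lambda>x. coverage P ?S (canonical_ext K pts (q \<omega>)) x - (1 - \<alpha>))
                   \<ge> ennreal (1/64 * sqrt ((1 + \<kappa>) * \<alpha> * (1 - \<alpha>) * real K / real m))})"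
      unfolding rate .
  qed
  have "mass_regular_on \<alpha> (\<lambda>_. unif01) (space X)"
    using assms(1,2) prob_space_unif01
    by (intro uniform_like_mass_regular[of _ 1 1]) (auto simp: uniform_like_def)
  then have regular: "\<exists>X0\<in>sets X. emeasure source X0 = 1 \<and> mass_regular_on \<alpha> (\<lambda>_. unif01) X0"
    using S.emeasure_space_1 by (intro bexI[of _ "space X"]) auto
  have bounded: "\<exists>C::real. AE x in source. RN_deriv source target x \<le> ennreal C"
  proof
    show "AE x in source. RN_deriv source target x \<le> ennreal (1 + \<kappa>)"
      using RN_deriv_source_target
      by eventually_elim (use \<kappa>_pos in \<open>auto simp: indicator_def intro!: ennreal_leI\<close>)
  qed
  show ?thesis
  proof (rule exI[of _ source], rule exI[of _ target], rule exI[of _ pts], rule exI[of _ "\<lambda>_. unif01"],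
      rule exI[of _ ?S], intro conjI)
    show "\<forall>A\<in>sets X. emeasure target A = (\<Sum>k=1..K. emeasure (return X (pts k)) A) / of_nat K"
      using emeasure_target by blast
    show "inj_on pts {1..K}" by (rule inj_on_subset[OF inj_pts]) auto
    show "\<forall>k\<in>{1..K}. pts k \<in> space X \<and> {pts k} \<in> sets X" using pts_space pts_sets by auto
    show "\<exists>C::real. AE x in source. RN_deriv source target x \<le> ennreal C" by (rule bounded)
    show "\<exists>X0\<in>sets X. emeasure source X0 = 1 \<and> mass_regular_on \<alpha> (\<lambda>_. unif01) X0" by (rule regular)
  qed (use prob_space_source prob_space_target unif01_kernel absolutely_continuous_source_target
      chi_square_source_target bound in blast | simp)+
qed

end
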